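(* For every integer $s\geq 1$, Subset Vertex Cover can be solved in polynomial time for $(sP_1+P_4)$-free graphs.
   Context: For a graph $G=(V,E)$ and $T\subseteq V$, a $T$-vertex cover is a set $S_T\subseteq V$ containing at least one end-vertex of every edge incident to a vertex of $T$. The problem Subset Vertex Cover takes as input a graph $G=(V,E)$, a subset $T\subseteq V$ and a positive integer $k$, and asks whether $G$ has a $T$-vertex cover of size at most $k$. $sP_1+P_4$ denotes the disjoint union of $s$ isolated vertices and a path on 4 vertices; a graph is $H$-free if it has no induced subgraph isomorphic to $H$. *)

theory Defs
  imports
    "HOL-Library.Log_Nat"
    "HOL-Computational_Algebra.Polynomial"
begin

section \<open>Finite simple graphs\<close>

record 'a graph =
  verts :: "'a set"
  edges :: "'a set set"

definition finite_simple_graph :: "'a graph \<Rightarrow> bool" where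
  "finite_simple_graph G \<longleftrightarrow>
     finite (verts G) \<and> (\<forall>e \<in> edges G. e \<subseteq> verts G \<and> card e = 2)"

definition induced_subgraph :: "'a graph \<Rightarrow> 'a set \<Rightarrow> 'a graph" where
  "induced_subgraph G U = \<lparr>verts = U, edges = {e \<in> edges G. e \<subseteq> U}\<rparr>"

definition graph_isomorphic :: "'a graph \<Rightarrow> 'b graph \<Rightarrow> bool" where
  "graph_isomorphic G H \<longleftrightarrow>
     (\<exists>f. bij_betw f (verts G) (verts H) \<and>
          (\<forall>u \<in> verts G. \<forall>v \<in> verts G. {u, v} \<in> edges G \<longleftrightarrow> {f u, f v} \<in> edges H))"

definition graph_free :: "'b graph \<Rightarrow> 'a graph \<Rightarrow> bool" where
  "graph_free H G \<longleftrightarrow> (\<forall>U \<subseteq> verts G. \<not> graph_isomorphic (induced_subgraph G U) H)"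

definition path_graph :: "nat \<Rightarrow> nat graph" where
  "path_graph r = \<lparr>verts = {..<r}, edges = {{i, Suc i} | i. Suc i < r}\<rparr>"

definition graph_disjoint_union :: "'a graph \<Rightarrow> 'b graph \<Rightarrow> ('a + 'b) graph" where
  "graph_disjoint_union G H =
     \<lparr>verts = verts G <+> verts H,
      edges = (\<lambda>e. Inl ` e) ` edges G \<union> (\<lambda>e. Inr ` e) ` edges H\<rparr>"

definition graph_copies :: "nat \<Rightarrow> 'a graph \<Rightarrow> (nat \<times> 'a) graph" where
  "graph_copies s G =
     \<lparr>verts = {..<s} \<times> verts G,
      edges = {Pair i ` e | i e. i < s \<and> e \<in> edges G}\<rparr>"

definition sP1_plus_P4 :: "nat \<Rightarrow> (nat \<times> nat + nat) graph" where
  "sP1_plus_P4 s = graph_disjoint_union (graph_copies s (path_graph 1)) (path_graph 4)"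


section \<open>Subset Vertex Cover\<close>

definition subset_vertex_cover :: "'a graph \<Rightarrow> 'a set \<Rightarrow> 'a set \<Rightarrow> bool" where
  "subset_vertex_cover G T S \<longleftrightarrow>
     S \<subseteq> verts G \<and> (\<forall>e \<in> edges G. e \<inter> T \<noteq> {} \<longrightarrow> e \<inter> S \<noteq> {})"

text \<open>
  Vertices of an input graph on \<open>n\<close> vertices are numbered \<open>0, \<dots>, n - 1\<close>.
  The instances are restricted to a class \<open>C\<close> of graphs, which is a promise: nothing is
  required of an algorithm on graphs outside \<open>C\<close>.
\<close>

type_synonym svc_input = "nat graph \<times> nat set \<times> nat"

definition svc_instances :: "nat graph set \<Rightarrow> svc_input set" where
  "svc_instances C =
     {(G, T, k). finite_simple_graph G \<and> verts G = {..<card (verts G)} \<and> G \<in> C \<and>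
                 T \<subseteq> verts G \<and> k \<ge> 1}"

definition svc_yes :: "svc_input set" where
  "svc_yes = {(G, T, k). \<exists>S. subset_vertex_cover G T S \<and> card S \<le> k}"

fun svc_encode :: "svc_input \<Rightarrow> nat list" where
  "svc_encode (G, T, k) =
     (let n = card (verts G) in
      n # k # map (\<lambda>v. of_bool (v \<in> T)) [0..<n]
        @ concat (map (\<lambda>u. map (\<lambda>v. of_bool ({u, v} \<in> edges G)) [0..<n]) [0..<n]))"


section \<open>Polynomial time on random access machines\<close>

text \<open>
  A RAM has registers \<open>0, 1, 2, \<dots>\<close> holding natural numbers and read-only access to its
  input, a finite sequence of natural numbers. Every instruction takes one unit of time.
  Since there is no multiplication, the bit length of register contents grows by at most one
  per step (beyond the constants of the program and the input entries), so polynomial time in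
  this model is the same as polynomial time on Turing machines.
\<close>

datatype ram_instr =
    Const nat nat
  | Add nat nat nat
  | Sub nat nat nat
  | Load nat nat
  | Store nat nat
  | Read nat nat
  | Jump nat
  | JumpPos nat nat

type_synonym ram_prog = "ram_instr list"

type_synonym ram_state = "nat \<times> (nat \<Rightarrow> nat)"  \<comment> \<open>program counter and registers\<close>

fun ram_exec :: "nat list \<Rightarrow> ram_instr \<Rightarrow> ram_state \<Rightarrow> ram_state" where
  "ram_exec inp (Const i c) (pc, r) = (Suc pc, r(i := c))"
| "ram_exec inp (Add i j l) (pc, r) = (Suc pc, r(i := r j + r l))"
| "ram_exec inp (Sub i j l) (pc, r) = (Suc pc, r(i := r j - r l))"
| "ram_exec inp (Load i j) (pc, r) = (Suc pc, r(i := r (r j)))"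
| "ram_exec inp (Store i j) (pc, r) = (Suc pc, r(r i := r j))"
| "ram_exec inp (Read i j) (pc, r) =
     (Suc pc, r(i := (if r j < length inp then inp ! r j else 0)))"
| "ram_exec inp (Jump a) (pc, r) = (a, r)"
| "ram_exec inp (JumpPos i a) (pc, r) = (if r i > 0 then a else Suc pc, r)"

definition ram_halted :: "ram_prog \<Rightarrow> ram_state \<Rightarrow> bool" where
  "ram_halted P st \<longleftrightarrow> length P \<le> fst st"

definition ram_step :: "ram_prog \<Rightarrow> nat list \<Rightarrow> ram_state \<Rightarrow> ram_state" where
  "ram_step P inp st = (if ram_halted P st then st else ram_exec inp (P ! fst st) st)"

definition ram_run :: "ram_prog \<Rightarrow> nat list \<Rightarrow> nat \<Rightarrow> ram_state" where
  "ram_run P inp t = (ram_step P inp ^^ t) (0, \<lambda>_. 0)"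

definition ram_answers_within :: "ram_prog \<Rightarrow> nat list \<Rightarrow> nat \<Rightarrow> bool \<Rightarrow> bool" where
  "ram_answers_within P inp t b \<longleftrightarrow>
     ram_halted P (ram_run P inp t) \<and> snd (ram_run P inp t) 0 = of_bool b"

definition input_length :: "nat list \<Rightarrow> nat" where
  "input_length inp = (\<Sum>x\<leftarrow>inp. max 1 (floorlog 2 x))"

definition poly_time_solvable :: "('i \<Rightarrow> nat list) \<Rightarrow> 'i set \<Rightarrow> 'i set \<Rightarrow> bool" where
  "poly_time_solvable enc I Y \<longleftrightarrow>
     (\<exists>(P :: ram_prog) (p :: nat poly). \<forall>x \<in> I.
        ram_answers_within P (enc x) (poly p (input_length (enc x))) (x \<in> Y))"

definition svc_poly_time_for :: "nat graph set \<Rightarrow> bool" where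
  "svc_poly_time_for C \<longleftrightarrow> poly_time_solvable svc_encode (svc_instances C) svc_yes"

end

(*
A set is a T-vertex cover iff its complement I is such that every vertex of T in I is isolated
in the graph induced by I, so |I| is to be maximised. Guess a set A of at most s vertices of I in T,
all of them if there are at most s, and let U be the set of vertices without neighbours in A; then I
is a subset of U. The vertices of A are isolated in U, so they may be treated as not belonging to T.
If A is all of I in T, then the best I is U minus (T minus A). Otherwise A is an independent set
of size s, so U induces a P4-free graph. By Seinsche's theorem such a graph has two twins as
soon as it has two vertices, and merging twins, with weights recording the optimum inside each
merged module, computes the optimum for U.

The algorithm is written in a language whose loops all run for the number of vertices, so that the
running time of a program is bounded by a polynomial that can be read off its syntax.
*)

theory Submission
  imports Defs
begin

section \<open>A loop language and its compilation to random access machines\<close>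

text \<open>The algorithm never decides which case a guess falls into. For every tuple it compares
  both candidate values with the budget. This is sound for any tuple: each value is the size of an
  actual subset of U that is good once the tuple is removed from T, and such a set is good for T
  because no vertex of U is adjacent to a vertex of the tuple. Only completeness needs a right guess
  and a P4-free U.

  A merged module carries two weights because of adjacent twins. A good set meeting both sides of a
  join avoids T, so besides the two optima one must know how many vertices outside T each side has;
  for nonadjacent twins the optima simply add.

  The guess costs at most (n + 1)^s rounds, and the nesting depth of the loops depends on s alone.
  As the machine does not multiply, the matrix is addressed through a table of row offsets built by
  repeated addition.\<close>

datatype expr = N nat | Inp expr | Arr nat expr | Plus expr expr | Minus expr expr

datatype com =
    Skip
  | Set nat expr expr
  | Seq com com  (infixr \<open>;;\<close> 60)
  | If expr com com
  | For nat nat com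

type_synonym store = "nat \<Rightarrow> nat \<Rightarrow> nat"

definition input_at :: "nat list \<Rightarrow> nat \<Rightarrow> nat" where
  "input_at inp i = (if i < length inp then inp ! i else 0)"

abbreviation upd :: "store \<Rightarrow> nat \<Rightarrow> nat \<Rightarrow> nat \<Rightarrow> store" where
  "upd \<sigma> j i x \<equiv> \<sigma>(j := (\<sigma> j)(i := x))"

primrec eval :: "(nat \<Rightarrow> nat) \<Rightarrow> expr \<Rightarrow> store \<Rightarrow> nat" where
  "eval rd (N c) \<sigma> = c"
| "eval rd (Inp e) \<sigma> = rd (eval rd e \<sigma>)"
| "eval rd (Arr j e) \<sigma> = \<sigma> j (eval rd e \<sigma>)"
| "eval rd (Plus e e') \<sigma> = eval rd e \<sigma> + eval rd e' \<sigma>"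
| "eval rd (Minus e e') \<sigma> = eval rd e \<sigma> - eval rd e' \<sigma>"

primrec exec :: "(nat \<Rightarrow> nat) \<Rightarrow> com \<Rightarrow> store \<Rightarrow> store" where
  "exec rd Skip \<sigma> = \<sigma>"
| "exec rd (Set j a e) \<sigma> = upd \<sigma> j (eval rd a \<sigma>) (eval rd e \<sigma>)"
| "exec rd (c ;; c') \<sigma> = exec rd c' (exec rd c \<sigma>)"
| "exec rd (If e c c') \<sigma> = (if eval rd e \<sigma> > 0 then exec rd c \<sigma> else exec rd c' \<sigma>)"
| "exec rd (For j i c) \<sigma> = fold (\<lambda>x \<tau>. exec rd c (upd \<tau> j i x)) [0..<rd 0] \<sigma>"

lemma fold_upt_invariant:
  assumes "P 0 \<sigma>" "\<And>i \<tau>. i < n \<Longrightarrow> P i \<tau> \<Longrightarrow> P (Suc i) (f i \<tau>)"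
  shows "P n (fold f [0..<n] \<sigma>)"
  using assms by (induction n) auto

text \<open>
  Cell \<open>i\<close> of array \<open>j\<close> lives in register \<open>K + 8 * i + j\<close>; loop counters and intermediate
  values of expressions live in the registers below \<open>K\<close>, out of reach of assignments.
\<close>

definition cell :: "nat \<Rightarrow> nat \<Rightarrow> nat \<Rightarrow> nat" where
  "cell K j i = K + 8 * i + j"

text \<open>Three doublings multiply the index by 8 without a multiplication instruction; the number
  of arrays is a power of two for this reason.\<close>

definition address_code :: "nat \<Rightarrow> nat \<Rightarrow> nat \<Rightarrow> ram_prog" where
  "address_code K d j = [Add d d d, Add d d d, Add d d d, Const (Suc d) (K + j), Add d d (Suc d)]"

text \<open>The registers from \<open>d\<close> upwards form an evaluation stack: the value ends up
  in \<open>d\<close>, and a left operand waits there while the right one is computed from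
  \<open>Suc d\<close> on.\<close>

primrec expr_code :: "nat \<Rightarrow> nat \<Rightarrow> expr \<Rightarrow> ram_prog" where
  "expr_code K d (N c) = [Const d c]"
| "expr_code K d (Inp e) = expr_code K d e @ [Read d d]"
| "expr_code K d (Arr j e) = expr_code K d e @ address_code K d j @ [Load d d]"
| "expr_code K d (Plus e e') = expr_code K d e @ expr_code K (Suc d) e' @ [Add d d (Suc d)]"
| "expr_code K d (Minus e e') = expr_code K d e @ expr_code K (Suc d) e' @ [Sub d d (Suc d)]"

text \<open>Height of the evaluation stack. An array access needs at least two registers because
  \<open>address_code\<close> uses \<open>Suc d\<close> for the base address.\<close>

primrec expr_regs :: "expr \<Rightarrow> nat" where
  "expr_regs (N c) = 1"
| "expr_regs (Inp e) = expr_regs e"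
| "expr_regs (Arr j e) = max 2 (expr_regs e)"
| "expr_regs (Plus e e') = max (expr_regs e) (Suc (expr_regs e'))"
| "expr_regs (Minus e e') = max (expr_regs e) (Suc (expr_regs e'))"

primrec expr_ok :: "expr \<Rightarrow> bool" where
  "expr_ok (N c) = True"
| "expr_ok (Inp e) = expr_ok e"
| "expr_ok (Arr j e) = (j < 8 \<and> expr_ok e)"
| "expr_ok (Plus e e') = (expr_ok e \<and> expr_ok e')"
| "expr_ok (Minus e e') = (expr_ok e \<and> expr_ok e')"

text \<open>Jump targets are absolute, so the code depends on its start address \<open>a\<close>;
  \<open>l\<close> is the first free register. The else branch comes first because
  \<open>JumpPos\<close> leaves on a positive value. A loop keeps its counter in \<open>l\<close>
  and its bound in \<open>l + 1\<close>, compares them at \<open>a + 3\<close> by truncated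
  subtraction, and copies the counter into its cell before each round; writes to that cell cannot
  change the number of rounds.\<close>

primrec com_code :: "nat \<Rightarrow> nat \<Rightarrow> nat \<Rightarrow> com \<Rightarrow> ram_prog" where
  "com_code K l a Skip = []"
| "com_code K l a (Set j e e') =
     expr_code K l e @ address_code K l j @ expr_code K (Suc l) e' @ [Store l (Suc l)]"
| "com_code K l a (c ;; c') =
     (let p = com_code K l a c in p @ com_code K l (a + length p) c')"
| "com_code K l a (If e c c') =
     (let p = expr_code K l e;
          q' = com_code K l (a + length p + 1) c';
          b = a + length p + length q' + 2;
          q = com_code K l b c
      in p @ [JumpPos l b] @ q' @ [Jump (b + length q)] @ q)"
| "com_code K l a (For j i c) =
     (let q = com_code K (l + 2) (a + 8) c
      in [Const l 0, Const (l + 1) 0, Read (l + 1) (l + 1),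
          Sub (l + 2) (l + 1) l, JumpPos (l + 2) (a + 6), Jump (a + 11 + length q),
          Const (l + 2) (cell K j i), Store (l + 2) l]
         @ q @ [Const (l + 2) 1, Add l l (l + 2), Jump (a + 3)])"

primrec com_regs :: "com \<Rightarrow> nat" where
  "com_regs Skip = 0"
| "com_regs (Set j e e') = max 2 (max (expr_regs e) (Suc (expr_regs e')))"
| "com_regs (c ;; c') = max (com_regs c) (com_regs c')"
| "com_regs (If e c c') = max (expr_regs e) (max (com_regs c) (com_regs c'))"
| "com_regs (For j i c) = max 3 (com_regs c + 2)"

primrec com_ok :: "com \<Rightarrow> bool" where
  "com_ok Skip = True"
| "com_ok (Set j e e') = (j < 8 \<and> expr_ok e \<and> expr_ok e')"
| "com_ok (c ;; c') = (com_ok c \<and> com_ok c')"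
| "com_ok (If e c c') = (expr_ok e \<and> com_ok c \<and> com_ok c')"
| "com_ok (For j i c) = (j < 8 \<and> com_ok c)"

section \<open>Time bounds read off the syntax\<close>

primrec expr_size :: "expr \<Rightarrow> nat" where
  "expr_size (N c) = 1"
| "expr_size (Inp e) = expr_size e + 1"
| "expr_size (Arr j e) = expr_size e + 6"
| "expr_size (Plus e e') = expr_size e + expr_size e' + 1"
| "expr_size (Minus e e') = expr_size e + expr_size e' + 1"

text \<open>\<open>If\<close> adds the bounds of both branches instead of taking their maximum,
  which keeps the bound polynomial. In \<open>For\<close>, the 7 counts 4 instructions before and 3
  after the body in each round, and the 6 counts 3 for entering and 3 for leaving the loop.\<close>

primrec com_time :: "com \<Rightarrow> nat \<Rightarrow> nat" where
  "com_time Skip n = 0"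
| "com_time (Set j e e') n = expr_size e + expr_size e' + 6"
| "com_time (c ;; c') n = com_time c n + com_time c' n"
| "com_time (If e c c') n = expr_size e + 2 + com_time c n + com_time c' n"
| "com_time (For j i c) n = 6 + n * (com_time c n + 7)"

lemma com_time_poly: "\<exists>p :: nat poly. \<forall>n. com_time c n = poly p n"
proof (induction c)
  case Skip
  then show ?case by (auto intro: exI[of _ 0])
next
  case (Set j e e')
  then show ?case by (auto intro!: exI[of _ "[:expr_size e + expr_size e' + 6:]"])
next
  case (Seq c c')
  then obtain p q where "\<forall>n. com_time c n = poly p n" "\<forall>n. com_time c' n = poly q n" by blast
  then show ?case by (auto intro!: exI[of _ "p + q"])
next
  case (If e c c')
  then obtain p q where "\<forall>n. com_time c n = poly p n" "\<forall>n. com_time c' n = poly q n" by blast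
  then show ?case by (auto intro!: exI[of _ "[:expr_size e + 2:] + p + q"])
next
  case (For j i c)
  then obtain p where "\<forall>n. com_time c n = poly p n" by blast
  then show ?case by (auto intro!: exI[of _ "[:6:] + [:0, 1:] * (p + [:7:])"])
qed

text \<open>Natural coefficients make every such polynomial monotone, so a bound in the number of
  vertices becomes a bound in the input length.\<close>

lemma poly_nat_mono: "m \<le> n \<Longrightarrow> poly p m \<le> poly (p :: nat poly) n"
  by (induction p) (auto intro!: mult_le_mono add_mono)

section \<open>Runs of the machine and jump-free code\<close>

primrec straight :: "ram_instr \<Rightarrow> bool" where
  "straight (Const i c) = True"
| "straight (Add i j l) = True"
| "straight (Sub i j l) = True"
| "straight (Load i j) = True"
| "straight (Store i j) = True"
| "straight (Read i j) = True"
| "straight (Jump a) = False"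
| "straight (JumpPos i a) = False"

text \<open>Register contents after a jump-free block do not depend on where the block is placed;
  the program counter 0 is a dummy.\<close>

definition effect :: "nat list \<Rightarrow> ram_prog \<Rightarrow> (nat \<Rightarrow> nat) \<Rightarrow> nat \<Rightarrow> nat" where
  "effect inp p r = fold (\<lambda>i r. snd (ram_exec inp i (0, r))) p r"

lemma effect_simps [simp]:
  "effect inp [] r = r"
  "effect inp (i # p) r = effect inp p (snd (ram_exec inp i (0, r)))"
  "effect inp (p @ q) r = effect inp q (effect inp p r)"
  by (simp_all add: effect_def)

definition code_at :: "ram_prog \<Rightarrow> nat \<Rightarrow> ram_prog \<Rightarrow> bool" where
  "code_at P a p \<longleftrightarrow> (\<forall>i < length p. a + i < length P \<and> P ! (a + i) = p ! i)"

lemma code_at_Nil [simp]: "code_at P a []"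
  by (simp add: code_at_def)

lemma code_at_Cons [simp]:
  "code_at P a (i # p) \<longleftrightarrow> a < length P \<and> P ! a = i \<and> code_at P (Suc a) p"
  by (auto simp: code_at_def nth_Cons less_Suc_eq_0_disj split: nat.splits)

lemma code_at_append [simp]:
  "code_at P a (p @ q) \<longleftrightarrow> code_at P a p \<and> code_at P (a + length p) q"
  by (induction p arbitrary: a) auto

lemma code_at_self: "code_at (p @ q) 0 p"
  by (simp add: code_at_def nth_append)

text \<open>An upper bound on the number of steps, not the exact number, lets branches of different
  lengths share one bound.\<close>

definition runs :: "ram_prog \<Rightarrow> nat list \<Rightarrow> nat \<Rightarrow> ram_state \<Rightarrow> ram_state \<Rightarrow> bool" where
  "runs P inp b st st' \<longleftrightarrow> (\<exists>t \<le> b. (ram_step P inp ^^ t) st = st')"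

lemma runs_refl: "runs P inp b st st"
  unfolding runs_def by (intro exI[of _ 0]) simp

lemma runs_trans:
  assumes "runs P inp b st st'" "runs P inp b' st' st''"
  shows "runs P inp (b + b') st st''"
proof -
  obtain t t' where "t \<le> b" "(ram_step P inp ^^ t) st = st'"
    "t' \<le> b'" "(ram_step P inp ^^ t') st' = st''" using assms unfolding runs_def by blast
  then show ?thesis unfolding runs_def
    by (intro exI[of _ "t' + t"]) (simp add: funpow_add)
qed

lemma runs_mono: "runs P inp b st st' \<Longrightarrow> b \<le> b' \<Longrightarrow> runs P inp b' st st'"
  unfolding runs_def using le_trans by blast

lemma runs_step:
  assumes "a < length P" "ram_exec inp (P ! a) (a, r) = st" "runs P inp b st st'"
  shows "runs P inp (Suc b) (a, r) st'"
proof -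
  have "ram_step P inp (a, r) = st" using assms by (simp add: ram_step_def ram_halted_def)
  then have "runs P inp 1 (a, r) st" unfolding runs_def by (intro exI[of _ 1]) simp
  from runs_trans[OF this assms(3)] show ?thesis by simp
qed

lemma runs_straight:
  assumes "code_at P a p" "list_all straight p"
  shows "runs P inp (length p) (a, r) (a + length p, effect inp p r)"
  using assms
proof (induction p arbitrary: a r)
  case Nil
  then show ?case by (simp add: runs_refl)
next
  case (Cons i p)
  have "runs P inp (length p) (Suc a, snd (ram_exec inp i (0, r)))
    (Suc a + length p, effect inp p (snd (ram_exec inp i (0, r))))"
    using Cons.IH[of "Suc a" "snd (ram_exec inp i (0, r))"] Cons.prems by simp
  moreover have "ram_exec inp i (a, r) = (Suc a, snd (ram_exec inp i (0, r)))"
    using Cons.prems by (cases i) auto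
  ultimately have "runs P inp (Suc (length p)) (a, r)
    (Suc a + length p, effect inp p (snd (ram_exec inp i (0, r))))"
    using Cons.prems by (intro runs_step) auto
  then show ?case by simp
qed

lemma straight_address_code: "list_all straight (address_code K d j)"
  by (simp add: address_code_def)

lemma straight_expr_code: "list_all straight (expr_code K d e)"
  by (induction e arbitrary: d) (auto simp: straight_address_code)

lemma length_expr_code [simp]: "length (expr_code K d e) = expr_size e"
  by (induction e arbitrary: d) (auto simp: address_code_def)

section \<open>Correctness of the compiler\<close>

definition represents :: "nat \<Rightarrow> (nat \<Rightarrow> nat) \<Rightarrow> store \<Rightarrow> bool" where
  "represents K r \<sigma> \<longleftrightarrow> (\<forall>j < 8. \<forall>i. \<sigma> j i = r (cell K j i))"

lemma cell_eq_iff [simp]: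
  "j < 8 \<Longrightarrow> j' < 8 \<Longrightarrow> cell K j i = cell K j' i' \<longleftrightarrow> j = j' \<and> i = i'"
proof -
  assume j: "j < 8" "j' < 8"
  have "j = j'" if "8 * i + j = 8 * i' + j'"
  proof -
    have "(8 * i + j) mod 8 = (8 * i' + j') mod 8" using that by (rule arg_cong)
    then show ?thesis using j by simp
  qed
  then show ?thesis by (auto simp: cell_def add.assoc)
qed

lemma cell_ge: "K \<le> cell K j i"
  by (simp add: cell_def)

lemma represents_cong:
  "represents K r \<sigma> \<Longrightarrow> (\<And>i. K \<le> i \<Longrightarrow> r' i = r i) \<Longrightarrow> represents K r' \<sigma>"
  by (auto simp: represents_def cell_ge)

lemma represents_upd:
  "represents K r \<sigma> \<Longrightarrow> j < 8 \<Longrightarrow> represents K (r(cell K j i := x)) (upd \<sigma> j i x)"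
  by (auto simp: represents_def)

lemma effect_address_code:
  assumes "Suc d < K"
  shows "effect inp (address_code K d j) r d = cell K j (r d)"
    "i < d \<or> K \<le> i \<Longrightarrow> effect inp (address_code K d j) r i = r i"
  using assms by (auto simp: address_code_def cell_def)

text \<open>The second conjunct carries the induction: registers below \<open>d\<close> hold pending
  left operands, and those from \<open>K\<close> on hold the store.\<close>

lemma effect_expr_code:
  assumes "represents K r \<sigma>" "d + expr_regs e \<le> K" "expr_ok e"
  shows "effect inp (expr_code K d e) r d = eval (input_at inp) e \<sigma> \<and>
    (\<forall>i. i < d \<or> K \<le> i \<longrightarrow> effect inp (expr_code K d e) r i = r i)"
  using assms
proof (induction e arbitrary: d r)
  case (N c)
  then show ?case by auto
next
  case (Inp e)
  \<comment> \<open>This puts register \<open>d\<close> below \<open>K\<close>, so that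
    \<open>Read d d\<close> leaves the store alone.\<close>
  have "expr_regs e > 0" by (induction e) auto
  then show ?case using Inp.prems Inp.IH[of r d] by (auto simp: input_at_def)
next
  case (Arr j e)
  let ?r = "effect inp (expr_code K d e) r"
  have IH: "?r d = eval (input_at inp) e \<sigma>" "\<And>i. i < d \<or> K \<le> i \<Longrightarrow> ?r i = r i"
    using Arr.prems Arr.IH[of r d] by auto
  have rep: "represents K ?r \<sigma>" using Arr.prems(1) IH(2) represents_cong by blast
  have d: "Suc d < K" using Arr.prems by simp
  show ?case using Arr.prems rep IH d effect_address_code[OF d]
    by (simp add: represents_def cell_ge)
next
  case (Plus e e')
  let ?r = "effect inp (expr_code K d e) r"
  have IH: "?r d = eval (input_at inp) e \<sigma>" "\<And>i. i < d \<or> K \<le> i \<Longrightarrow> ?r i = r i"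
    using Plus.prems Plus.IH(1)[of r d] by auto
  have rep: "represents K ?r \<sigma>" using Plus.prems(1) IH(2) represents_cong by blast
  show ?case using Plus.prems Plus.IH(2)[OF rep, of "Suc d"] IH by auto
next
  case (Minus e e')
  let ?r = "effect inp (expr_code K d e) r"
  have IH: "?r d = eval (input_at inp) e \<sigma>" "\<And>i. i < d \<or> K \<le> i \<Longrightarrow> ?r i = r i"
    using Minus.prems Minus.IH(1)[of r d] by auto
  have rep: "represents K ?r \<sigma>" using Minus.prems(1) IH(2) represents_cong by blast
  show ?case using Minus.prems Minus.IH(2)[OF rep, of "Suc d"] IH by auto
qed

text \<open>That registers below \<open>l\<close> survive protects the counters of the enclosing
  loops: the body of a loop at \<open>l\<close> is compiled with \<open>l + 2\<close> as its first
  free register.\<close>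

lemma com_code_correct:
  assumes "code_at P a (com_code K l a c)" "represents K r \<sigma>" "l + com_regs c \<le> K" "com_ok c"
  shows "\<exists>r'. runs P inp (com_time c (input_at inp 0)) (a, r) (a + length (com_code K l a c), r') \<and>
    represents K r' (exec (input_at inp) c \<sigma>) \<and> (\<forall>i<l. r' i = r i)"
  using assms
proof (induction c arbitrary: a l r \<sigma>)
  case Skip
  then show ?case by (auto intro: runs_refl)
next
  case (Set j e e')
  let ?p = "com_code K l a (Set j e e')"
  let ?r1 = "effect inp (expr_code K l e) r"
  let ?r2 = "effect inp (address_code K l j) ?r1"
  let ?r3 = "effect inp (expr_code K (Suc l) e') ?r2"
  have r1: "?r1 l = eval (input_at inp) e \<sigma>" "\<And>i. i < l \<or> K \<le> i \<Longrightarrow> ?r1 i = r i"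
    using Set.prems effect_expr_code[of K r \<sigma> l e inp] by auto
  have l: "Suc l < K" using Set.prems by simp
  have r2: "?r2 l = cell K j (eval (input_at inp) e \<sigma>)" "\<And>i. i < l \<or> K \<le> i \<Longrightarrow> ?r2 i = r i"
    using effect_address_code[OF l] r1 by auto
  have rep: "represents K ?r2 \<sigma>" using Set.prems(2) r2(2) represents_cong by blast
  have r3: "?r3 (Suc l) = eval (input_at inp) e' \<sigma>" "\<And>i. i < Suc l \<or> K \<le> i \<Longrightarrow> ?r3 i = ?r2 i"
    using Set.prems effect_expr_code[OF rep, of "Suc l" e' inp] by auto
  have "represents K ?r3 \<sigma>" using rep r3(2) represents_cong by blast
  then have rep': "represents K (effect inp ?p r) (exec (input_at inp) (Set j e e') \<sigma>)"
    using Set.prems r3 r2 by (simp add: represents_upd)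
  have len: "length ?p = com_time (Set j e e') (input_at inp 0)"
    by (simp add: address_code_def)
  have "runs P inp (length ?p) (a, r) (a + length ?p, effect inp ?p r)"
    using Set.prems by (intro runs_straight) (auto simp: straight_address_code straight_expr_code)
  moreover have "effect inp ?p r i = r i" if "i < l" for i
    using that l r2 r3 cell_ge[of K j "eval (input_at inp) e \<sigma>"] by auto
  ultimately show ?case using rep' len by metis
next
  case (Seq c c')
  let ?p = "com_code K l a c"
  have regs: "l + com_regs c \<le> K" "l + com_regs c' \<le> K" using Seq.prems(3) by simp_all
  obtain r1 where r1: "runs P inp (com_time c (input_at inp 0)) (a, r) (a + length ?p, r1)"
    "represents K r1 (exec (input_at inp) c \<sigma>)" "\<forall>i<l. r1 i = r i"
    using Seq.prems Seq.IH(1)[of a l r \<sigma>] regs by (auto simp: Let_def)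
  let ?q = "com_code K l (a + length ?p) c'"
  obtain r2 where r2: "runs P inp (com_time c' (input_at inp 0)) (a + length ?p, r1)
      (a + length ?p + length ?q, r2)"
    "represents K r2 (exec (input_at inp) c' (exec (input_at inp) c \<sigma>))" "\<forall>i<l. r2 i = r1 i"
    using Seq.prems Seq.IH(2)[of "a + length ?p" l r1] r1(2) regs by (auto simp: Let_def)
  show ?case using runs_trans[OF r1(1) r2(1)] r1(3) r2(2,3)
    by (intro exI[of _ r2]) (auto simp: Let_def add.assoc)
next
  case (If e c c')
  have regs: "l + expr_regs e \<le> K" "l + com_regs c \<le> K" "l + com_regs c' \<le> K"
    using If.prems(3) by simp_all
  define p where "p = expr_code K l e"
  define q' where "q' = com_code K l (a + length p + 1) c'"
  define b where "b = a + length p + length q' + 2"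
  define q where "q = com_code K l b c"
  have code: "com_code K l a (If e c c') = p @ [JumpPos l b] @ q' @ [Jump (b + length q)] @ q"
    by (simp add: p_def q'_def b_def q_def Let_def)
  have at: "code_at P a p" "a + length p < length P" "P ! (a + length p) = JumpPos l b"
    "code_at P (a + length p + 1) q'" "b - 1 < length P" "P ! (b - 1) = Jump (b + length q)"
    "code_at P b q"
    using If.prems(1) unfolding code by (auto simp: b_def)
  let ?r1 = "effect inp p r"
  have r1: "?r1 l = eval (input_at inp) e \<sigma>" "\<And>i. i < l \<or> K \<le> i \<Longrightarrow> ?r1 i = r i"
    using If.prems(2,4) regs effect_expr_code[of K r \<sigma> l e inp] unfolding p_def by auto
  have rep: "represents K ?r1 \<sigma>" using If.prems(2) r1(2) represents_cong by blast
  have run1: "runs P inp (expr_size e) (a, r) (a + length p, ?r1)"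
    using runs_straight[OF at(1), of inp r] unfolding p_def
    by (simp add: straight_expr_code)
  have len: "a + length (com_code K l a (If e c c')) = b + length q"
    unfolding code by (simp add: b_def)
  show ?case
  proof (cases "eval (input_at inp) e \<sigma> > 0")
    case True
    obtain r2 where r2: "runs P inp (com_time c (input_at inp 0)) (b, ?r1) (b + length q, r2)"
      "represents K r2 (exec (input_at inp) c \<sigma>)" "\<forall>i<l. r2 i = ?r1 i"
      using If.prems(4) regs If.IH(1)[of b l ?r1 \<sigma>] at(7) rep unfolding q_def by auto
    have "runs P inp (Suc (com_time c (input_at inp 0))) (a + length p, ?r1) (b + length q, r2)"
      by (rule runs_step[OF at(2) _ r2(1)]) (use True r1 at(3) in simp)
    from runs_trans[OF run1 this]
    have "runs P inp (com_time (If e c c') (input_at inp 0)) (a, r) (b + length q, r2)"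
      by (rule runs_mono) simp
    then show ?thesis unfolding len using r2 r1 True by (intro exI[of _ r2]) auto
  next
    case False
    obtain r2 where r2: "runs P inp (com_time c' (input_at inp 0)) (a + length p + 1, ?r1) (b - 1, r2)"
      "represents K r2 (exec (input_at inp) c' \<sigma>)" "\<forall>i<l. r2 i = ?r1 i"
      using If.prems(4) regs If.IH(2)[of "a + length p + 1" l ?r1 \<sigma>] at(4) rep unfolding q'_def b_def by auto
    have "runs P inp 1 (b - 1, r2) (b + length q, r2)"
      using at(5,6) by (auto simp: numeral_eq_Suc intro!: runs_step runs_refl)
    from runs_trans[OF r2(1) this]
    have "runs P inp (com_time c' (input_at inp 0) + 1) (a + length p + 1, ?r1) (b + length q, r2)" .
    then have "runs P inp (Suc (com_time c' (input_at inp 0) + 1)) (a + length p, ?r1) (b + length q, r2)"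
      by (rule runs_step[OF at(2), rotated]) (use False r1 at(3) in simp)
    from runs_trans[OF run1 this]
    have "runs P inp (com_time (If e c c') (input_at inp 0)) (a, r) (b + length q, r2)"
      by (rule runs_mono) simp
    then show ?thesis unfolding len using r2 r1 False by (intro exI[of _ r2]) auto
  qed
next
  case (For j i c)
  define q where "q = com_code K (l + 2) (a + 8) c"
  define n where "n = input_at inp 0"
  define t where "t = com_time c n"
  define \<tau> where "\<tau> m = fold (\<lambda>x \<tau>. exec (input_at inp) c (upd \<tau> j i x)) [0..<m] \<sigma>" for m
  have code: "com_code K l a (For j i c) =
      [Const l 0, Const (l + 1) 0, Read (l + 1) (l + 1),
          Sub (l + 2) (l + 1) l, JumpPos (l + 2) (a + 6), Jump (a + 11 + length q),
          Const (l + 2) (cell K j i), Store (l + 2) l]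
         @ q @ [Const (l + 2) 1, Add l l (l + 2), Jump (a + 3)]"
    by (simp add: q_def Let_def)
  note at = For.prems(1)[unfolded code, simplified]
  have atq: "code_at P (a + 8) q"
    using For.prems(1) unfolding code code_at_append by (simp add: eval_nat_numeral)
  have \<tau>_Suc: "\<tau> (Suc m) = exec (input_at inp) c (upd (\<tau> m) j i m)" for m
    by (simp add: \<tau>_def)
  have K: "l + 2 < K" "l + 2 + com_regs c \<le> K" "j < 8" "com_ok c" using For.prems by auto
  \<comment> \<open>Invariant at the loop test \<open>a + 3\<close>: after \<open>m\<close>
    completed rounds, register \<open>l\<close> holds \<open>m\<close> and its successor still holds
    the bound.\<close>
  have loop: "\<exists>r'. runs P inp (m * (t + 7)) (a + 3, r0) (a + 3, r') \<and>
      represents K r' (\<tau> m) \<and> r' l = m \<and> r' (Suc l) = n \<and> (\<forall>i<l. r' i = r0 i)"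
    if "m \<le> n" "represents K r0 \<sigma>" "r0 l = 0" "r0 (Suc l) = n" for m r0
    using that(1)
  proof (induction m)
    case 0
    show ?case using that by (intro exI[of _ r0]) (auto simp: \<tau>_def runs_refl)
  next
    case (Suc m)
    then obtain r1 where r1: "runs P inp (m * (t + 7)) (a + 3, r0) (a + 3, r1)"
      "represents K r1 (\<tau> m)" "r1 l = m" "r1 (Suc l) = n" "\<forall>i<l. r1 i = r0 i" by auto
    let ?r2 = "r1(l + 2 := cell K j i, cell K j i := m)"
    have c: "cell K j i \<ge> K" by (rule cell_ge)
    have "represents K (r1(l + 2 := cell K j i)) (\<tau> m)"
      by (rule represents_cong[OF r1(2)]) (use K in auto)
    then have rep: "represents K ?r2 (upd (\<tau> m) j i m)" using K(3) represents_upd by blast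
    obtain r3 where r3: "runs P inp t (a + 8, ?r2) (a + 8 + length q, r3)"
      "represents K r3 (\<tau> (Suc m))" "\<forall>i<l+2. r3 i = ?r2 i"
      using For.IH[OF atq[unfolded q_def] rep K(2,4)]
      unfolding q_def t_def n_def \<tau>_Suc by blast
    let ?r4 = "r3(l + 2 := 1, l := Suc m)"
    have "represents K ?r4 (\<tau> (Suc m))"
      by (rule represents_cong[OF r3(2)]) (use K in auto)
    moreover have r3': "r3 l = m" "r3 (Suc l) = n" "\<forall>i<l. r3 i = r0 i"
      using r3(3) r1 c K by auto
    moreover have "runs P inp (m * (t + 7) + (4 + (t + 3))) (a + 3, r0) (a + 3, ?r4)"
    proof (rule runs_trans[OF r1(1)])
      have "runs P inp 4 (a + 3, r1) (a + 8, ?r2)"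
        using at Suc.prems r1 K
        by (auto simp: numeral_eq_Suc fun_upd_twist intro!: runs_step runs_refl)
      moreover have "runs P inp 3 (a + 8 + length q, r3) (a + 3, ?r4)"
        using at r3'
        by (auto simp: numeral_eq_Suc intro!: runs_step runs_refl)
      ultimately show "runs P inp (4 + (t + 3)) (a + 3, r1) (a + 3, ?r4)"
        using r3(1) by (meson runs_trans runs_mono le_refl add_mono numeral_le_iff)
    qed
    moreover have "?r4 l = Suc m \<and> ?r4 (Suc l) = n \<and> (\<forall>i<l. ?r4 i = r0 i)" using r3' by auto
    moreover have "m * (t + 7) + (4 + (t + 3)) = Suc m * (t + 7)" by (simp add: algebra_simps)
    ultimately show ?case by metis
  qed
  let ?r0 = "r(l := 0, l + 1 := n)"
  have "represents K ?r0 \<sigma>"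
    by (rule represents_cong[OF For.prems(2)]) (use K in auto)
  then obtain r1 where r1: "runs P inp (n * (t + 7)) (a + 3, ?r0) (a + 3, r1)"
      "represents K r1 (\<tau> n)" "r1 l = n" "r1 (Suc l) = n" "\<forall>i<l. r1 i = ?r0 i"
    using loop[of n ?r0] by auto
  let ?r2 = "r1(l + 2 := 0)"
  have enter: "runs P inp 3 (a, r) (a + 3, ?r0)"
    using at by (auto simp: numeral_eq_Suc n_def input_at_def intro!: runs_step runs_refl)
  have leave: "runs P inp 3 (a + 3, r1) (a + length (com_code K l a (For j i c)), ?r2)"
    using at r1 unfolding code by (auto simp: numeral_eq_Suc intro!: runs_step runs_refl)
  have "runs P inp (3 + n * (t + 7) + 3) (a, r) (a + length (com_code K l a (For j i c)), ?r2)"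
    by (rule runs_trans[OF runs_trans[OF enter r1(1)] leave])
  moreover have "represents K ?r2 (\<tau> n)"
    by (rule represents_cong[OF r1(2)]) (use K in auto)
  moreover have "3 + n * (t + 7) + 3 = com_time (For j i c) (input_at inp 0)"
    by (simp add: n_def t_def)
  moreover have "\<tau> n = exec (input_at inp) (For j i c) \<sigma>" by (simp add: \<tau>_def n_def)
  moreover have "\<forall>i<l. ?r2 i = r i" using r1(5) by simp
  ultimately show ?case by metis
qed

text \<open>The two final instructions move the answer from cell 0 of array 0, which is register
  \<open>K\<close>, to register 0. The \<open>Suc\<close> makes \<open>K\<close> positive, so that
  loading the address into register 0 does not overwrite the answer first.\<close>

definition compile :: "com \<Rightarrow> ram_prog" where
  "compile c = (let K = Suc (com_regs c) in com_code K 0 0 c @ [Const 0 K, Load 0 0])"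

text \<open>Halted states are fixed, so a run that stops early is still in its final state at the
  prescribed time.\<close>

lemma runs_halted:
  assumes "runs P inp b st st'" "ram_halted P st'" "b \<le> b'"
  shows "(ram_step P inp ^^ b') st = st'"
proof -
  obtain t where t: "t \<le> b" "(ram_step P inp ^^ t) st = st'" using assms(1) unfolding runs_def by blast
  have "(ram_step P inp ^^ k) st' = st'" for k
    using assms(2) by (induction k) (auto simp: ram_step_def)
  then have "(ram_step P inp ^^ ((b' - t) + t)) st = st'"
    using t(2) by (simp only: funpow_add o_apply)
  then show ?thesis using t(1) assms(3) by simp
qed

text \<open>All loops run as often as the first input entry says, and \<open>len\<close> bounds this
  number by the input length. The summand 2 pays for fetching the answer.\<close>

lemma poly_time_solvable_if_exec:
  assumes ok: "com_ok c"
    and out: "\<And>x. x \<in> I \<Longrightarrow> exec (input_at (enc x)) c (\<lambda>_ _. 0) 0 0 = of_bool (x \<in> Y)"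
    and len: "\<And>x. x \<in> I \<Longrightarrow> input_at (enc x) 0 \<le> input_length (enc x)"
  shows "poly_time_solvable enc I Y"
proof -
  obtain p where p: "\<And>n. com_time c n = poly p n" using com_time_poly by blast
  show ?thesis unfolding poly_time_solvable_def
  proof (intro exI[of _ "compile c"] exI[of _ "p + [:2:]"] ballI)
    fix x assume x: "x \<in> I"
    define inp where "inp = enc x"
    define K where "K = Suc (com_regs c)"
    define q where "q = com_code K 0 0 c"
    define P where "P = q @ [Const 0 K, Load 0 0]"
    have P: "compile c = P" by (simp add: compile_def Let_def K_def P_def q_def)
    obtain r where r: "runs P inp (com_time c (input_at inp 0)) (0, \<lambda>_. 0) (length q, r)"
      "represents K r (exec (input_at inp) c (\<lambda>_ _. 0))"
      using com_code_correct[of P 0 K 0 c "\<lambda>_. 0" "\<lambda>_ _. 0" inp] ok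
      by (auto simp: q_def P_def K_def code_at_self represents_def)
    have "runs P inp 2 (length q, r) (length P, r(0 := r K))"
      by (auto simp: numeral_eq_Suc P_def nth_append K_def intro!: runs_step runs_refl)
    from runs_trans[OF r(1) this] have
      run: "runs P inp (com_time c (input_at inp 0) + 2) (0, \<lambda>_. 0) (length P, r(0 := r K))" .
    have "r K = of_bool (x \<in> Y)"
      using r(2) out[OF x] unfolding represents_def inp_def
      by (metis add_0_right cell_def mult_0_right zero_less_numeral)
    moreover have "com_time c (input_at inp 0) + 2 \<le> poly (p + [:2:]) (input_length inp)"
      using poly_nat_mono[OF len[OF x], of p] by (simp add: p inp_def)
    ultimately have "ram_run P inp (poly (p + [:2:]) (input_length inp)) = (length P, r(0 := of_bool (x \<in> Y)))"
      using runs_halted[OF run] unfolding ram_run_def by (simp only: ram_halted_def fst_conv le_refl)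
    then show "ram_answers_within (compile c) (enc x) (poly (p + [:2:]) (input_length (enc x))) (x \<in> Y)"
      unfolding ram_answers_within_def P inp_def by (simp only: ram_halted_def fst_conv snd_conv fun_upd_same le_refl simp_thms)
  qed
qed

section \<open>Twins in cographs\<close>

text \<open>The four vertices are distinct, so loops of \<open>E\<close> are harmless and the
  complement can be taken as plain negation of the relation.\<close>

definition contains_P4 :: "('a \<Rightarrow> 'a \<Rightarrow> bool) \<Rightarrow> 'a set \<Rightarrow> bool" where
  "contains_P4 E U \<longleftrightarrow> (\<exists>a\<in>U. \<exists>b\<in>U. \<exists>c\<in>U. \<exists>d\<in>U. distinct [a, b, c, d] \<and>
     E a b \<and> E b c \<and> E c d \<and> \<not> E a c \<and> \<not> E a d \<and> \<not> E b d)"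

lemma contains_P4I:
  assumes "{a, b, c, d} \<subseteq> U" "distinct [a, b, c, d]" "E a b" "E b c" "E c d" "\<not> E a c" "\<not> E a d" "\<not> E b d"
  shows "contains_P4 E U"
  using assms unfolding contains_P4_def by blast

lemma contains_P4_mono: "contains_P4 E U \<Longrightarrow> U \<subseteq> W \<Longrightarrow> contains_P4 E W"
  unfolding contains_P4_def by blast

text \<open>The path on four vertices is self-complementary: the complement of the path a, b, c, d
  is the path c, a, d, b.\<close>

lemma contains_P4_complement:
  assumes "symp E" "contains_P4 (\<lambda>x y. \<not> E x y) U"
  shows "contains_P4 E U"
proof -
  obtain a b c d where "a \<in> U" "b \<in> U" "c \<in> U" "d \<in> U" "distinct [a, b, c, d]"
    "\<not> E a b" "\<not> E b c" "\<not> E c d" "E a c" "E a d" "E b d"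
    using assms(2) unfolding contains_P4_def by blast
  then show ?thesis
    using sympD[OF assms(1)] by (intro contains_P4I[of c a d b]) auto
qed

text \<open>Admitting both values of \<open>c\<close> makes the notion self-complementary, so the
  inductive step needs a direct argument for the disconnected case only.\<close>

definition homogeneous_split :: "('a \<Rightarrow> 'a \<Rightarrow> bool) \<Rightarrow> 'a set \<Rightarrow> 'a set \<Rightarrow> 'a set \<Rightarrow> bool" where
  "homogeneous_split E U A B \<longleftrightarrow> A \<union> B = U \<and> A \<inter> B = {} \<and> A \<noteq> {} \<and> B \<noteq> {} \<and>
     (\<exists>c. \<forall>a\<in>A. \<forall>b\<in>B. E a b = c)"

lemma homogeneous_split_complement:
  "homogeneous_split (\<lambda>x y. \<not> E x y) U A B \<longleftrightarrow> homogeneous_split E U A B"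
  unfolding homogeneous_split_def by (metis (no_types, lifting))

text \<open>If \<open>v\<close> misses one side, the graph stays disconnected; if \<open>v\<close>
  sees all of \<open>F\<close>, it splits off as a join. Otherwise \<open>v\<close> has a neighbour
  on each side and a non-neighbour, say in \<open>A\<close>. The non-neighbours of \<open>v\<close>
  in \<open>A\<close> then form a part without edges to the rest: an edge from such an
  \<open>x\<close> to a neighbour \<open>z\<close> of \<open>v\<close> in \<open>A\<close> would
  give the induced path b, v, z, x with \<open>b\<close> in \<open>B\<close>.\<close>

lemma homogeneous_split_insert:
  assumes "symp E" "A \<union> B = F" "A \<inter> B = {}" "A \<noteq> {}" "B \<noteq> {}" "\<And>a b. a \<in> A \<Longrightarrow> b \<in> B \<Longrightarrow> \<not> E a b"
    "v \<notin> F" "\<not> contains_P4 E (insert v F)"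
  shows "\<exists>A B. homogeneous_split E (insert v F) A B"
proof -
  have sym: "E x y \<longleftrightarrow> E y x" for x y using assms(1) by (auto dest: sympD)
  have main: "\<exists>A B. homogeneous_split E (insert v F) A B"
    if AB: "A \<union> B = F" "A \<inter> B = {}" "\<And>a b. a \<in> A \<Longrightarrow> b \<in> B \<Longrightarrow> \<not> E a b"
      and b: "b \<in> B" "E v b" and y: "y \<in> A" "\<not> E v y" for A B b y
  proof -
    let ?Y = "{x \<in> A. \<not> E v x}"
    have "\<not> E x z" if "x \<in> ?Y" "z \<in> insert v F - ?Y" for x z
    proof
      assume E: "E x z"
      then have z: "z \<in> A" "E v z" using that AB sym by blast+
      have "distinct [b, v, z, x]" using z that AB b assms(7) by auto
      moreover have "{b, v, z, x} \<subseteq> insert v F" using z that AB(1) b(1) by auto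
      moreover have "E b v" "E v z" "E z x" "\<not> E b z" "\<not> E b x" "\<not> E v x"
        using E z that AB(3) b sym by blast+
      ultimately have "contains_P4 E (insert v F)" using contains_P4I by metis
      then show False using assms(8) by simp
    qed
    then have "homogeneous_split E (insert v F) ?Y (insert v F - ?Y)"
      unfolding homogeneous_split_def using AB(1) b y assms(7)
      by (intro conjI exI[of _ False]) blast+
    then show ?thesis by blast
  qed
  consider "\<forall>a\<in>A. \<not> E v a" | "\<forall>b\<in>B. \<not> E v b" | "\<forall>x\<in>F. E v x"
    | a b y where "a \<in> A" "E v a" "b \<in> B" "E v b" "y \<in> F" "\<not> E v y" by blast
  then show ?thesis
  proof cases
    case 1
    have "\<not> E a b" if "a \<in> A" "b \<in> insert v B" for a b
      using that 1 assms(6) sym by blast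
    then have "homogeneous_split E (insert v F) A (insert v B)"
      unfolding homogeneous_split_def using assms(2-5,7)
      by (intro conjI exI[of _ False]) blast+
    then show ?thesis by blast
  next
    case 2
    then have "\<not> E a b" if "a \<in> insert v A" "b \<in> B" for a b
      using that assms(6) by blast
    then have "homogeneous_split E (insert v F) (insert v A) B"
      unfolding homogeneous_split_def using assms(2-5,7)
      by (intro conjI exI[of _ False]) blast+
    then show ?thesis by blast
  next
    case 3
    then have "homogeneous_split E (insert v F) {v} F"
      unfolding homogeneous_split_def using assms(2,4,7)
      by (intro conjI exI[of _ True]) blast+
    then show ?thesis by blast
  next
    case 4
    show ?thesis
    proof (cases "y \<in> A")
      case True
      then show ?thesis using main[of A B b y] 4 assms(2,3,6) by blast
    next
      case False
      then have "y \<in> B" using 4 assms(2) by blast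
      moreover have "\<not> E b a" if "a \<in> A" "b \<in> B" for a b using that assms(6) sym by blast
      ultimately show ?thesis using main[of B A a y] 4 assms(2,3) by blast
    qed
  qed
qed

text \<open>Seinsche's theorem; the split \<open>(A, B)\<close> is a disconnection of the graph or of its complement.\<close>

lemma cograph_homogeneous_split:
  assumes "finite U" "symp E" "\<not> contains_P4 E U" "card U \<ge> 2"
  shows "\<exists>A B. homogeneous_split E U A B"
  using assms(1,3,4)
proof (induction U rule: finite_induct)
  case empty
  then show ?case by simp
next
  case (insert v F)
  show ?case
  proof (cases "card F \<ge> 2")
    case True
    then obtain A B where "homogeneous_split E F A B"
      using insert contains_P4_mono[of E F] by blast
    then obtain c where AB: "A \<union> B = F" "A \<inter> B = {}" "A \<noteq> {}" "B \<noteq> {}" "\<forall>a\<in>A. \<forall>b\<in>B. E a b = c"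
      unfolding homogeneous_split_def by blast
    show ?thesis
    proof (cases c)
      case False
      then show ?thesis
        using homogeneous_split_insert[OF assms(2) AB(1-4) _ insert(2,4)] AB(5) by simp
    next
      case True
      \<comment> \<open>A join is a disconnection of the complement, which is P4-free as well; the
        resulting split of the complement is a split of the graph.\<close>
      have "symp (\<lambda>x y. \<not> E x y)" using assms(2) by (auto simp: symp_def)
      then show ?thesis
        using homogeneous_split_insert[of "\<lambda>x y. \<not> E x y" A B F v] AB True insert
          contains_P4_complement[OF assms(2)] unfolding homogeneous_split_complement by blast
    qed
  next
    case False
    then have "card F = 1" using insert by simp
    then obtain x where "F = {x}" by (auto simp: card_1_singleton_iff)
    then have "homogeneous_split E (insert v F) {v} F"
      unfolding homogeneous_split_def using insert by auto
    then show ?thesis by blast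
  qed
qed

definition twins :: "('a \<Rightarrow> 'a \<Rightarrow> bool) \<Rightarrow> 'a set \<Rightarrow> 'a \<Rightarrow> 'a \<Rightarrow> bool" where
  "twins E U u v \<longleftrightarrow> u \<in> U \<and> v \<in> U \<and> u \<noteq> v \<and> (\<forall>w \<in> U - {u, v}. E u w = E v w)"

text \<open>Twins inside one side of a homogeneous split are twins in the whole graph, since the
  other side sees all of that side alike. The descent ends when both sides are single vertices,
  which are twins for lack of a third vertex.\<close>

lemma cograph_has_twins:
  assumes "finite U" "symp E" "\<not> contains_P4 E U" "card U \<ge> 2"
  shows "\<exists>u v. twins E U u v"
  using assms(1,3,4)
proof (induction U rule: finite_psubset_induct)
  case (psubset U)
  obtain A B c where AB: "A \<union> B = U" "A \<inter> B = {}" "A \<noteq> {}" "B \<noteq> {}" "\<forall>a\<in>A. \<forall>b\<in>B. E a b = c"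
    using cograph_homogeneous_split[OF psubset(1) assms(2) psubset(3,4)]
    unfolding homogeneous_split_def by blast
  have sym: "E x y \<longleftrightarrow> E y x" for x y using assms(2) by (auto dest: sympD)
  have lift: "\<exists>u v. twins E U u v" if card: "card A \<ge> 2" and AB': "A \<union> B = U" "A \<inter> B = {}" "B \<noteq> {}"
    and c: "\<forall>a\<in>A. \<forall>b\<in>B. E a b = c" for A B
  proof -
    have "A \<subset> U" using that by blast
    then obtain u v where uv: "twins E A u v"
      using psubset.IH[of A] psubset.prems(1) card contains_P4_mono[of E A U] by blast
    have "E u w = E v w" if w: "w \<in> U - {u, v}" for w
    proof (cases "w \<in> A")
      case True
      then show ?thesis using uv w unfolding twins_def by simp
    next
      case False
      then have "w \<in> B" using w AB' by blast
      then show ?thesis using uv c unfolding twins_def by simp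
    qed
    then have "twins E U u v" using uv AB'(1) unfolding twins_def by blast
    then show ?thesis by blast
  qed
  have "finite A" "finite B" using AB(1) psubset(1) by auto
  then consider "card A \<ge> 2" | "card B \<ge> 2" | "card A = 1" "card B = 1"
    using AB(3,4) by (metis One_nat_def Suc_1 card_gt_0_iff le_antisym not_less_eq_eq Suc_leI)
  then show ?case
  proof cases
    case 1
    then show ?thesis using lift AB by blast
  next
    case 2
    then show ?thesis using lift[of B A] AB sym by blast
  next
    case 3
    then obtain a b where "A = {a}" "B = {b}" by (auto simp: card_1_singleton_iff)
    then have "twins E U a b" using AB unfolding twins_def by auto
    then show ?thesis by blast
  qed
qed

section \<open>Complements of vertex covers\<close>

definition good :: "('a \<Rightarrow> 'a \<Rightarrow> bool) \<Rightarrow> 'a set \<Rightarrow> 'a set \<Rightarrow> bool" where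
  "good E T I \<longleftrightarrow> (\<forall>t \<in> I \<inter> T. \<forall>x \<in> I. \<not> E t x)"

definition max_good :: "('a \<Rightarrow> 'a \<Rightarrow> bool) \<Rightarrow> 'a set \<Rightarrow> 'a set \<Rightarrow> nat \<Rightarrow> bool" where
  "max_good E T U m \<longleftrightarrow> (\<exists>I \<subseteq> U. good E T I \<and> card I = m) \<and> (\<forall>I \<subseteq> U. good E T I \<longrightarrow> card I \<le> m)"

lemma good_subset: "good E T I \<Longrightarrow> J \<subseteq> I \<Longrightarrow> good E T J"
  unfolding good_def by blast

lemma max_good_singleton: "\<not> E x x \<Longrightarrow> max_good E T {x} 1"
  unfolding max_good_def good_def
  by (auto intro!: exI[of _ "{x}"] simp: subset_singleton_iff)

lemma max_good_disjoint_union: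
  assumes "symp E" "finite A" "finite B" "A \<inter> B = {}" "\<And>a b. a \<in> A \<Longrightarrow> b \<in> B \<Longrightarrow> \<not> E a b"
    "max_good E T A m" "max_good E T B m'"
  shows "max_good E T (A \<union> B) (m + m')"
proof -
  have sym: "E x y \<longleftrightarrow> E y x" for x y using assms(1) by (auto dest: sympD)
  obtain I J where IJ: "I \<subseteq> A" "good E T I" "card I = m" "J \<subseteq> B" "good E T J" "card J = m'"
    using assms(6,7) unfolding max_good_def by blast
  have "card (I \<union> J) = m + m'"
    using IJ assms by (subst card_Un_disjoint) (auto dest: finite_subset)
  moreover have "good E T (I \<union> J)" using IJ assms(5) sym unfolding good_def by blast
  moreover have "card I \<le> m + m'" if "I \<subseteq> A \<union> B" "good E T I" for I
  proof -
    have "card I = card (I \<inter> A \<union> I \<inter> B)" using that(1) by (simp add: Int_Un_distrib[symmetric] inf_absorb1)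
    also have "\<dots> \<le> card (I \<inter> A) + card (I \<inter> B)" by (rule card_Un_le)
    also have "\<dots> \<le> m + m'"
      using assms(6,7) good_subset[OF that(2)] unfolding max_good_def by (intro add_mono) auto
    finally show ?thesis .
  qed
  ultimately show ?thesis unfolding max_good_def using IJ by (metis Un_mono)
qed

text \<open>A good set meeting \<open>T\<close> cannot meet both sides of a join.\<close>

lemma max_good_join:
  assumes "symp E" "finite A" "finite B" "A \<inter> B = {}" "\<And>a b. a \<in> A \<Longrightarrow> b \<in> B \<Longrightarrow> E a b"
    "max_good E T A m" "max_good E T B m'"
  shows "max_good E T (A \<union> B) (max m (max m' (card (A - T) + card (B - T))))"
proof -
  let ?N = "card (A - T) + card (B - T)"
  have sym: "E x y \<longleftrightarrow> E y x" for x y using assms(1) by (auto dest: sympD)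
  have N: "card ((A \<union> B) - T) = ?N" using assms(2-4)
    by (subst Un_Diff, subst card_Un_disjoint) auto
  obtain I J where IJ: "I \<subseteq> A" "good E T I" "card I = m" "J \<subseteq> B" "good E T J" "card J = m'"
    using assms(6,7) unfolding max_good_def by blast
  have "good E T ((A \<union> B) - T)" unfolding good_def by blast
  then have "\<exists>I \<subseteq> A \<union> B. good E T I \<and> card I = max m (max m' ?N)"
    using IJ N by (metis max_def Diff_subset le_supI1 le_supI2)
  moreover have "card I \<le> max m (max m' ?N)" if I: "I \<subseteq> A \<union> B" "good E T I" for I
  proof -
    consider "I \<subseteq> A" | "I \<subseteq> B" | a b where "a \<in> I" "a \<in> A" "b \<in> I" "b \<in> B" using I by blast
    then show ?thesis
    proof cases
      case 3
      have "t \<notin> T" if "t \<in> I" for t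
        using 3 I that assms(5) sym unfolding good_def by blast
      then have "I \<subseteq> (A \<union> B) - T" using I by blast
      then have "card I \<le> ?N" using N assms(2,3) by (metis card_mono finite_Diff finite_Un)
      then show ?thesis by simp
    qed (use assms(6,7) I in \<open>auto simp: max_good_def le_max_iff_disj\<close>)
  qed
  ultimately show ?thesis unfolding max_good_def by blast
qed

section \<open>Independent sets beside an induced path\<close>

text \<open>Freeness speaks of maps from an induced subgraph onto \<open>H\<close>; the inverse of
  the embedding on its image is such a map.\<close>

lemma not_graph_free_if_embedding:
  assumes "inj_on h (verts H)" "h ` verts H \<subseteq> verts G"
    and "\<And>x y. x \<in> verts H \<Longrightarrow> y \<in> verts H \<Longrightarrow> {h x, h y} \<in> edges G \<longleftrightarrow> {x, y} \<in> edges H"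
  shows "\<not> graph_free H G"
proof -
  let ?U = "h ` verts H" and ?f = "inv_into (verts H) h"
  have "bij_betw ?f ?U (verts H)" using assms(1) by (simp add: bij_betw_inv_into inj_on_imp_bij_betw)
  then have "graph_isomorphic (induced_subgraph G ?U) H"
    unfolding graph_isomorphic_def induced_subgraph_def using assms
    by (intro exI[of _ ?f]) (auto simp: inv_into_f_f)
  then show ?thesis using assms(2) unfolding graph_free_def by blast
qed

lemma verts_sP1_plus_P4: "verts (sP1_plus_P4 s) = (\<lambda>i. Inl (i, 0)) ` {..<s} \<union> Inr ` {..<4}"
  by (auto simp: sP1_plus_P4_def graph_disjoint_union_def graph_copies_def path_graph_def)

text \<open>The copies of \<open>path_graph 1\<close> are edgeless, so only the edges of the path
  remain.\<close>

lemma edges_sP1_plus_P4: "edges (sP1_plus_P4 s) = {{Inr 0, Inr 1}, {Inr 1, Inr 2}, {Inr 2, Inr 3}}"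
proof -
  have "{{i, Suc i} | i. Suc i < 4} = {{0, 1}, {1, 2}, {2, 3::nat}}"
    by (auto simp: less_Suc_eq numeral_eq_Suc)
  then show ?thesis
    by (auto simp: sP1_plus_P4_def graph_disjoint_union_def graph_copies_def path_graph_def)
qed

text \<open>
  Every vertex of \<open>A\<close> is isolated in the graph induced by \<open>U\<close>, while no vertex of an induced
  \<open>P\<^sub>4\<close> is, so an induced \<open>P\<^sub>4\<close> in \<open>U\<close> would extend by \<open>A\<close> to an induced \<open>sP\<^sub>1 + P\<^sub>4\<close>.
\<close>

lemma no_P4_beside_independent_set:
  assumes "graph_free (sP1_plus_P4 (card A)) G" "\<forall>e \<in> edges G. card e = 2" "finite A"
    "A \<subseteq> U" "U \<subseteq> verts G" "\<And>a u. a \<in> A \<Longrightarrow> u \<in> U \<Longrightarrow> {a, u} \<notin> edges G"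
  shows "\<not> contains_P4 (\<lambda>x y. {x, y} \<in> edges G) U"
proof
  let ?E = "\<lambda>x y. {x, y} \<in> edges G"
  assume "contains_P4 ?E U"
  then obtain a b c d where P: "a \<in> U" "b \<in> U" "c \<in> U" "d \<in> U" "distinct [a, b, c, d]"
    "?E a b" "?E b c" "?E c d" "\<not> ?E a c" "\<not> ?E a d" "\<not> ?E b d"
    unfolding contains_P4_def by blast
  obtain g where g: "bij_betw g {..<card A} A" using assms(3) by (metis ex_bij_betw_nat_finite lessThan_atLeast0)
  define h where "h = case_sum (\<lambda>(i, _::nat). g i) ((!) [a, b, c, d])"
  have loop: "\<not> ?E x x" for x using assms(2) by fastforce
  have sym: "?E x y \<longleftrightarrow> ?E y x" for x y by (simp add: insert_commute)
  have gA: "g i \<in> A" if "i < card A" for i using g that by (auto simp: bij_betw_def)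
  have PA: "a \<notin> A" "b \<notin> A" "c \<notin> A" "d \<notin> A" using P assms(6) sym by blast+
  have PP: "?E b a" "?E c b" "?E d c" "\<not> ?E c a" "\<not> ?E d a" "\<not> ?E d b"
    using P(6-) by (simp_all add: insert_commute)
  have AA: "\<not> ?E (g i) (g j)" if "i < card A" "j < card A" for i j
    using that gA assms(4,6) by blast
  have AP: "\<not> ?E (g i) u \<and> \<not> ?E u (g i)" if "i < card A" "u \<in> {a, b, c, d}" for i u
    using that gA[of i] assms(6)[of "g i" u] P(1-4) sym[of u] by auto
  have 4: "{..<4} = {0, 1, 2, 3::nat}" by auto
  have h: "h (Inl (i, 0)) = g i" "h (Inr 0) = a" "h (Inr 1) = b" "h (Inr (Suc 0)) = b" "h (Inr 2) = c" "h (Inr 3) = d" for i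
    by (simp_all add: h_def)
  have hP: "h (Inr k) \<in> {a, b, c, d}" if "k < 4" for k
    using that lessThan_iff[of k 4] unfolding 4 by (auto simp: h)
  have "\<not> graph_free (sP1_plus_P4 (card A)) G"
  proof (rule not_graph_free_if_embedding[of h])
    show "inj_on h (verts (sP1_plus_P4 (card A)))"
      using g gA PA P(5) unfolding verts_sP1_plus_P4 4
      by (auto simp: inj_on_def h bij_betw_def)
    show "h ` verts (sP1_plus_P4 (card A)) \<subseteq> verts G"
      using gA P(1-4) subsetD[OF assms(4)] subsetD[OF assms(5)] unfolding verts_sP1_plus_P4 4 by (auto simp: h)
    fix x y assume "x \<in> verts (sP1_plus_P4 (card A))" "y \<in> verts (sP1_plus_P4 (card A))"
    then consider i j where "x = Inl (i, 0)" "y = Inl (j, 0)" "i < card A" "j < card A"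
      | i k where "x = Inl (i, 0)" "y = Inr k" "i < card A" "k < 4"
      | i k where "x = Inr k" "y = Inl (i, 0)" "i < card A" "k < 4"
      | k m where "x = Inr k" "y = Inr m" "k < 4" "m < 4"
      unfolding verts_sP1_plus_P4 by blast
    then show "{h x, h y} \<in> edges G \<longleftrightarrow> {x, y} \<in> edges (sP1_plus_P4 (card A))"
    proof cases
      case 1
      then show ?thesis using AA by (simp add: h edges_sP1_plus_P4 doubleton_eq_iff)
    next
      case 2
      then show ?thesis using AP[of i "h (Inr k)"] hP[of k]
        by (simp add: h(1) edges_sP1_plus_P4 doubleton_eq_iff)
    next
      case 3
      then show ?thesis using AP[of i "h (Inr k)"] hP[of k]
        by (simp add: h(1) edges_sP1_plus_P4 doubleton_eq_iff)
    next
      case 4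
      then have "k \<in> {0, 1, 2, 3}" "m \<in> {0, 1, 2, 3}" by auto
      then show ?thesis using 4(1,2) P(6-) PP loop[of a] loop[of b] loop[of c] loop[of d]
        unfolding insert_iff empty_iff
        by (elim disjE FalseE) (simp_all add: h edges_sP1_plus_P4 doubleton_eq_iff)
    qed
  qed
  then show False using assms(1) by contradiction
qed

section \<open>Merging twins\<close>

text \<open>
  Invariant of the twin reduction: each \<open>x \<in> L\<close> stands for a module \<open>M x\<close> of the graph, with
  \<open>f x\<close> the size of a largest good set inside \<open>M x\<close> and \<open>g x\<close> that of one avoiding \<open>T\<close>.
\<close>

definition weights ::
    "('a \<Rightarrow> 'a \<Rightarrow> bool) \<Rightarrow> 'a set \<Rightarrow> 'a set \<Rightarrow> 'a set \<Rightarrow> ('a \<Rightarrow> nat) \<Rightarrow> ('a \<Rightarrow> nat) \<Rightarrow> bool" where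
  "weights E T U L f g \<longleftrightarrow> (\<exists>M.
     (\<forall>x\<in>L. x \<in> M x \<and> max_good E T (M x) (f x) \<and> card (M x - T) = g x) \<and>
     (\<forall>x\<in>L. \<forall>y\<in>L. x \<noteq> y \<longrightarrow> M x \<inter> M y = {} \<and> (\<forall>a\<in>M x. \<forall>b\<in>M y. E a b = E x y)) \<and>
     (\<Union>x\<in>L. M x) = U)"

lemma weights_cong:
  assumes "\<And>x. x \<in> L \<Longrightarrow> f x = f' x" "\<And>x. x \<in> L \<Longrightarrow> g x = g' x"
  shows "weights E T U L f g = weights E T U L f' g'"
  unfolding weights_def by (simp add: assms cong: ball_cong)

lemma weights_singletons:
  assumes "\<And>x. \<not> E x x"
  shows "weights E T U U (\<lambda>_. 1) (\<lambda>x. of_bool (x \<notin> T))"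
  unfolding weights_def
  by (intro exI[of _ "\<lambda>x. {x}"]) (auto simp: max_good_singleton[of E, unfolded One_nat_def] assms insert_Diff_if)

text \<open>Soundness of accepting on a weight: at every stage of the merging, each live weight is
  the size of an actual good set, however many vertices are still live.\<close>

lemma weights_max_good_le:
  assumes "weights E T U L f g" "x \<in> L"
  shows "\<exists>I \<subseteq> U. good E T I \<and> card I = f x"
proof -
  obtain M where "\<forall>x\<in>L. max_good E T (M x) (f x)" "(\<Union>x\<in>L. M x) = U"
    using assms(1) unfolding weights_def by blast
  then have "max_good E T (M x) (f x)" "M x \<subseteq> U" using assms(2) by auto
  then show ?thesis unfolding max_good_def by (meson subset_trans)
qed

text \<open>Completeness at the end of the merging: a single remaining module is all of
  \<open>U\<close>, so its weight is the optimum. The case \<open>I = {}\<close> covers an empty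
  \<open>L\<close>, where \<open>U\<close> is empty too.\<close>

lemma weights_one:
  assumes "weights E T U L f g" "L \<subseteq> {x}" "I \<subseteq> U" "good E T I"
  shows "I = {} \<or> x \<in> L \<and> card I \<le> f x"
proof -
  obtain M where "\<forall>x\<in>L. max_good E T (M x) (f x)" "(\<Union>x\<in>L. M x) = U"
    using assms(1) unfolding weights_def by blast
  then have "max_good E T (M x) (f x)" "I \<subseteq> M x" if "x \<in> L" using assms(2,3) that by auto
  moreover have "U = {}" if "x \<notin> L" using \<open>(\<Union>x\<in>L. M x) = U\<close> assms(2) that by auto
  ultimately show ?thesis using assms(3,4) unfolding max_good_def by auto
qed

text \<open>Twins agree on every other representative, so the union of their modules is again a
  module and \<open>u\<close> can represent it. Between the two modules there are all edges or none,
  according to \<open>E u v\<close>, which selects the formula for a join or for a disjoint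
  union.\<close>

lemma weights_merge_twins:
  assumes "weights E T U L f g" "twins E L u v" "symp E" "finite U"
  shows "weights E T U (L - {v})
    (f(u := if E u v then max (f u) (max (f v) (g u + g v)) else f u + f v)) (g(u := g u + g v))"
proof -
  obtain M where M: "\<And>x. x \<in> L \<Longrightarrow> x \<in> M x" "\<And>x. x \<in> L \<Longrightarrow> max_good E T (M x) (f x)"
    "\<And>x. x \<in> L \<Longrightarrow> card (M x - T) = g x"
    "\<And>x y. x \<in> L \<Longrightarrow> y \<in> L \<Longrightarrow> x \<noteq> y \<Longrightarrow> M x \<inter> M y = {}"
    "\<And>x y a b. x \<in> L \<Longrightarrow> y \<in> L \<Longrightarrow> x \<noteq> y \<Longrightarrow> a \<in> M x \<Longrightarrow> b \<in> M y \<Longrightarrow> E a b = E x y"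
    "(\<Union>x\<in>L. M x) = U"
    using assms(1) unfolding weights_def by blast
  have uv: "u \<in> L" "v \<in> L" "u \<noteq> v" and tw: "\<And>w. w \<in> L - {u, v} \<Longrightarrow> E u w = E v w"
    using assms(2) unfolding twins_def by blast+
  have sym: "E x y \<longleftrightarrow> E y x" for x y using assms(3) by (auto dest: sympD)
  have fin: "finite (M x)" if "x \<in> L" for x using M(6) assms(4) that by (metis UN_upper finite_subset)
  have disj: "M u \<inter> M v = {}" using M(4) uv by blast
  define M' where "M' = M(u := M u \<union> M v)"
  have "card (M' u - T) = g u + g v"
    unfolding M'_def using disj fin uv M(3)[symmetric]
    by (simp add: Un_Diff, subst card_Un_disjoint) auto
  moreover have "max_good E T (M' u) (if E u v then max (f u) (max (f v) (g u + g v)) else f u + f v)"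
    using max_good_join[OF assms(3) fin fin disj _ M(2) M(2)] M(5)[of u v]
      max_good_disjoint_union[OF assms(3) fin fin disj _ M(2) M(2)] uv M(3)
    unfolding M'_def by auto
  moreover have "M' x \<inter> M' y = {} \<and> (\<forall>a\<in>M' x. \<forall>b\<in>M' y. E a b = E x y)"
    if xy: "x \<in> L - {v}" "y \<in> L - {v}" "x \<noteq> y" for x y
  proof -
    consider "x = u" | "y = u" | "x \<noteq> u" "y \<noteq> u" by blast
    then show ?thesis
    proof cases
      case 1
      then have "E u y = E v y" "M v \<inter> M y = {}" "M u \<inter> M y = {}" using xy tw uv M(4) by blast+
      then show ?thesis using 1 xy uv M(5)[of u y] M(5)[of v y] unfolding M'_def by auto
    next
      case 2
      then have "E x u = E x v" "M x \<inter> M v = {}" "M x \<inter> M u = {}" using xy tw uv M(4) sym by blast+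
      then show ?thesis using 2 xy uv M(5)[of x u] M(5)[of x v] unfolding M'_def by auto
    next
      case 3
      then show ?thesis using xy M(4)[of x y] M(5)[of x y] unfolding M'_def by auto
    qed
  qed
  moreover have "(\<Union>x\<in>L - {v}. M' x) = U"
    using uv M(6) unfolding M'_def by (auto split: if_splits)
  moreover have "x \<in> M' x" if "x \<in> L - {v}" for x
    using that M(1) unfolding M'_def by auto
  moreover have "M' x = M x" if "x \<noteq> u" for x using that unfolding M'_def by simp
  ultimately show ?thesis unfolding weights_def
  proof (intro exI[of _ M'] conjI ballI impI, goal_cases)
    case (2 x)
    then show ?case using M(2)[of x] by (cases "x = u") auto
  next
    case (3 x)
    then show ?case using M(3)[of x] by (cases "x = u") auto
  qed (blast | simp)+
qed

section \<open>The program and its correctness\<close>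

text \<open>
  Use of the arrays: 0 scalars (cell 0 is the answer), 1 offsets of the rows of the adjacency
  matrix in the input, 2 which vertices are still live, 3 and 4 the weights \<open>f\<close> and \<open>g\<close>, 7 the
  current tuple of vertices.
\<close>

abbreviation "V i \<equiv> Arr 0 (N i)"

text \<open>Array 1 supplies the start of the matrix row, which expressions could only compute with
  a multiplication.\<close>

definition adj :: "expr \<Rightarrow> expr \<Rightarrow> expr" where
  "adj a b = Inp (Plus (Arr 1 a) b)"

definition neq :: "expr \<Rightarrow> expr \<Rightarrow> expr" where
  "neq a b = Plus (Minus a b) (Minus b a)"

definition maximum :: "expr \<Rightarrow> expr \<Rightarrow> expr" where
  "maximum a b = Plus a (Minus b a)"

primrec Ifs :: "expr list \<Rightarrow> com \<Rightarrow> com" where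
  "Ifs [] c = c"
| "Ifs (e # es) c = If e (Ifs es c) Skip"

text \<open>A good set of size \<open>e\<close> leaves a cover of size \<open>n - e\<close>;
  truncated subtraction gives 0 exactly if this is within the budget.\<close>

definition accept :: "expr \<Rightarrow> com" where
  "accept e = If (Minus (Inp (N 0)) (Plus (Inp (N 1)) e)) Skip (Set 0 (N 0) (N 1))"

text \<open>The matrix starts after the two entries for \<open>n\<close> and \<open>k\<close> and
  the \<open>n\<close> entries for \<open>T\<close>. Round \<open>x\<close> fills entry
  \<open>x + 1\<close>, so entry \<open>n\<close> is filled too: it serves the blank of the
  tuples.\<close>

definition row_offsets :: com where
  "row_offsets = Set 1 (N 0) (Plus (N 2) (Inp (N 0))) ;;
     For 0 1 (Set 1 (Plus (V 1) (N 1)) (Plus (Arr 1 (V 1)) (Inp (N 0))))"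

text \<open>Neighbours of the tuple cease to be live. Setting the weight in array 4 to 1 takes a
  tuple vertex out of \<open>T\<close>, as this weight counts vertices outside
  \<open>T\<close>.\<close>

primrec mark :: "nat \<Rightarrow> com" where
  "mark 0 = Skip"
| "mark (Suc i) = mark i ;;
     If (adj (Arr 7 (N i)) (V 1)) (Set 2 (V 1) (N 0)) Skip ;;
     If (neq (Arr 7 (N i)) (V 1)) Skip (Set 4 (V 1) (N 1))"

definition initialise :: "nat \<Rightarrow> com" where
  "initialise s = For 0 1 (Set 2 (V 1) (N 1) ;; Set 3 (V 1) (N 1) ;;
     Set 4 (V 1) (Minus (N 1) (Inp (Plus (N 2) (V 1)))) ;; mark s)"

text \<open>Serves the guess that contains all vertices of the sought set in \<open>T\<close>: the
  sum counts the live vertices outside the relaxed \<open>T\<close>.\<close>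

definition test_total :: com where
  "test_total = Set 0 (N 4) (N 0) ;;
     For 0 1 (If (Arr 2 (V 1)) (Set 0 (N 4) (Plus (V 4) (Arr 4 (V 1)))) Skip) ;; accept (V 4)"

text \<open>The candidate pair is in cells 1 and 2; cell 5 becomes 1 if some third live vertex tells
  the two apart.\<close>

definition distinguish :: com where
  "distinguish = Set 0 (N 5) (N 0) ;;
     For 0 3 (Ifs [Arr 2 (V 3), neq (V 1) (V 3), neq (V 2) (V 3), neq (adj (V 1) (V 3)) (adj (V 2) (V 3))]
       (Set 0 (N 5) (N 1)))"

text \<open>Array 3 is updated before array 4, because the value for a join uses the old weights of
  both vertices in array 4.\<close>

definition unite :: com where
  "unite =
     If (adj (V 1) (V 2))
       (Set 3 (V 1) (maximum (Arr 3 (V 1)) (maximum (Arr 3 (V 2)) (Plus (Arr 4 (V 1)) (Arr 4 (V 2))))))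
       (Set 3 (V 1) (Plus (Arr 3 (V 1)) (Arr 3 (V 2)))) ;;
     Set 4 (V 1) (Plus (Arr 4 (V 1)) (Arr 4 (V 2))) ;;
     Set 2 (V 2) (N 0)"

definition merge :: com where
  "merge = distinguish ;;
     Ifs [Minus (N 1) (V 5), Arr 2 (V 1), Arr 2 (V 2), neq (V 1) (V 2)] unite"

definition sweep :: com where
  "sweep = For 0 1 (For 0 2 merge)"

definition test_weights :: com where
  "test_weights = For 0 1 (Ifs [Arr 2 (V 1)] (accept (Arr 3 (V 1))))"

text \<open>One sweep per vertex is enough: on a P4-free live graph with at least two vertices,
  every sweep removes at least one.\<close>

definition try_tuple :: "nat \<Rightarrow> com" where
  "try_tuple s = initialise s ;; test_total ;; For 0 6 sweep ;; test_weights"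

text \<open>
  Tuples have entries in \<open>{0..n}\<close>, the non-vertex \<open>n\<close> being a blank, so that they represent
  all vertex sets with at most \<open>m\<close> elements.
\<close>

primrec for_tuples :: "nat \<Rightarrow> com \<Rightarrow> com" where
  "for_tuples 0 c = c"
| "for_tuples (Suc m) c = Set 7 (N m) (Inp (N 0)) ;; for_tuples m c ;; For 7 m (for_tuples m c)"

definition svc_program :: "nat \<Rightarrow> com" where
  "svc_program s = row_offsets ;; for_tuples s (try_tuple s)"

lemma com_ok_svc_program: "com_ok (svc_program s)"
proof -
  have "com_ok (mark i)" for i by (induction i) (auto simp: adj_def neq_def)
  moreover have "com_ok (for_tuples m c)" if "com_ok c" for m c using that by (induction m) auto
  ultimately show ?thesis
    by (simp add: svc_program_def row_offsets_def try_tuple_def initialise_def test_total_def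
        distinguish_def unite_def merge_def sweep_def test_weights_def accept_def adj_def neq_def maximum_def)
qed

section \<open>Semantics of the program pieces\<close>

lemma eval_neq_pos [simp]: "0 < eval rd (neq a b) \<sigma> \<longleftrightarrow> eval rd a \<sigma> \<noteq> eval rd b \<sigma>"
  by (auto simp: neq_def)

lemma eval_maximum [simp]: "eval rd (maximum a b) \<sigma> = max (eval rd a \<sigma>) (eval rd b \<sigma>)"
  by (auto simp: maximum_def)

lemma exec_Ifs [simp]:
  "exec rd (Ifs es c) \<sigma> = (if \<forall>e\<in>set es. eval rd e \<sigma> > 0 then exec rd c \<sigma> else \<sigma>)"
  by (induction es) auto

text \<open>
  The input reader \<open>rd\<close> presents a graph on \<open>{..<n}\<close> as \<open>svc_encode\<close> does; beyond the end of
  the input it reads \<open>0\<close>, which makes \<open>n\<close> look like an isolated vertex.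
\<close>

locale svc_reader =
  fixes rd :: "nat \<Rightarrow> nat" and n k :: nat and E :: "nat \<Rightarrow> nat \<Rightarrow> bool" and T :: "nat set"
  assumes rd_size: "rd 0 = n" and rd_budget: "rd (Suc 0) = k"
    and rd_T: "\<And>v. v < n \<Longrightarrow> rd (2 + v) = of_bool (v \<in> T)"
    and rd_E: "\<And>u v. u < n \<Longrightarrow> v < n \<Longrightarrow> rd (2 + n + u * n + v) = of_bool (E u v)"
    and rd_end: "\<And>v. rd (2 + n + n * n + v) = 0"
    and sym: "symp E" and irrefl: "\<And>x. \<not> E x x"
begin

lemma exec_For:
  assumes "P 0 \<sigma>" "\<And>x \<tau>. x < n \<Longrightarrow> P x \<tau> \<Longrightarrow> P (Suc x) (exec rd c (upd \<tau> j i x))"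
  shows "P n (exec rd (For j i c) \<sigma>)"
  using fold_upt_invariant[of P \<sigma> n "\<lambda>x \<tau>. exec rd c (upd \<tau> j i x)"] assms by (simp add: rd_size)

text \<open>The range includes \<open>u = n\<close>: the blank has an offset as well, pointing just
  past the end of the input.\<close>

definition rows :: "store \<Rightarrow> bool" where
  "rows \<sigma> \<longleftrightarrow> (\<forall>u\<le>n. \<sigma> 1 u = 2 + n + u * n)"

definition frame :: "store \<Rightarrow> store \<Rightarrow> bool" where
  "frame \<sigma> \<tau> \<longleftrightarrow> \<tau> 0 0 = \<sigma> 0 0 \<and> \<tau> 1 = \<sigma> 1 \<and> \<tau> 7 = \<sigma> 7"

definition live :: "store \<Rightarrow> nat set" where
  "live \<sigma> = {v. v < n \<and> \<sigma> 2 v > 0}"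

definition solvable :: bool where
  "solvable \<longleftrightarrow> (\<exists>I \<subseteq> {..<n}. good E T I \<and> n \<le> k + card I)"

lemma eval_adj:
  assumes "rows \<sigma>" "eval rd a \<sigma> = u" "eval rd b \<sigma> = v" "u \<le> n" "v < n"
  shows "eval rd (adj a b) \<sigma> = of_bool (u < n \<and> E u v)"
  using assms rd_E[of u v] rd_end[of v] by (cases "u = n") (auto simp: adj_def rows_def)

lemma exec_accept:
  "exec rd (accept e) \<sigma> = (if n \<le> k + eval rd e \<sigma> then upd \<sigma> 0 0 1 else \<sigma>)"
  by (auto simp: accept_def rd_size rd_budget)

lemma exec_row_offsets:
  assumes "\<sigma> 0 0 = 0"
  shows "rows (exec rd row_offsets \<sigma>) \<and> exec rd row_offsets \<sigma> 0 0 = 0"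
proof -
  let ?\<sigma> = "upd \<sigma> 1 0 (2 + n)"
  let ?c = "For 0 1 (Set 1 (Plus (V 1) (N 1)) (Plus (Arr 1 (V 1)) (Inp (N 0))))"
  have "(\<forall>u\<le>n. exec rd ?c ?\<sigma> 1 u = 2 + n + u * n) \<and> exec rd ?c ?\<sigma> 0 0 = 0"
    by (rule exec_For[where P = "\<lambda>x \<tau>. (\<forall>u\<le>x. \<tau> 1 u = 2 + n + u * n) \<and> \<tau> 0 0 = 0"])
      (use assms in \<open>auto simp: rd_size le_Suc_eq\<close>)
  then show ?thesis by (simp add: row_offsets_def rows_def rd_size)
qed

text \<open>Only position \<open>u\<close> of arrays 2 and 4 is ever written, so each test reads the
  original offsets and tuple.\<close>

lemma exec_mark:
  fixes \<sigma> m
  defines "u \<equiv> \<sigma> 0 1" and "\<tau> \<equiv> exec rd (mark m) \<sigma>"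
  shows "\<tau> 2 u = (if \<exists>i<m. rd (\<sigma> 1 (\<sigma> 7 i) + u) > 0 then 0 else \<sigma> 2 u) \<and>
    \<tau> 4 u = (if \<exists>i<m. \<sigma> 7 i = u then 1 else \<sigma> 4 u) \<and>
    (\<forall>v. v \<noteq> u \<longrightarrow> \<tau> 2 v = \<sigma> 2 v \<and> \<tau> 4 v = \<sigma> 4 v) \<and> (\<forall>j. j \<noteq> 2 \<and> j \<noteq> 4 \<longrightarrow> \<tau> j = \<sigma> j)"
  unfolding \<tau>_def
proof (induction m)
  case 0
  then show ?case by simp
next
  case (Suc m)
  define D where "D m \<longleftrightarrow> (\<exists>i<m. rd (\<sigma> 1 (\<sigma> 7 i) + u) > 0)" for m
  define A where "A m \<longleftrightarrow> (\<exists>i<m. \<sigma> 7 i = u)" for m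
  have Suc_D: "D (Suc m) \<longleftrightarrow> D m \<or> rd (\<sigma> 1 (\<sigma> 7 m) + u) > 0"
    and Suc_A: "A (Suc m) \<longleftrightarrow> A m \<or> \<sigma> 7 m = u" by (auto simp: D_def A_def less_Suc_eq)
  have u: "\<sigma> 0 (Suc 0) = u" by (simp add: u_def)
  show ?case using Suc unfolding D_def[symmetric] A_def[symmetric] Suc_D Suc_A
    by (cases "rd (\<sigma> 1 (\<sigma> 7 m) + u) > 0"; cases "\<sigma> 7 m = u") (simp_all add: adj_def u)
qed

lemma exec_initialise:
  fixes \<sigma> s
  defines "\<tau> \<equiv> exec rd (initialise s) \<sigma>"
  shows "frame \<sigma> \<tau>"
    and "live \<tau> = {v. v < n \<and> (\<forall>i<s. rd (\<sigma> 1 (\<sigma> 7 i) + v) = 0)}"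
    and "\<And>v. v < n \<Longrightarrow> \<tau> 3 v = 1"
    and "\<And>v. v < n \<Longrightarrow> \<tau> 4 v = of_bool (v \<notin> T - \<sigma> 7 ` {..<s})"
proof -
  let ?P = "\<lambda>x \<tau>. frame \<sigma> \<tau> \<and> (\<forall>v<x. \<tau> 2 v = of_bool (\<forall>i<s. rd (\<sigma> 1 (\<sigma> 7 i) + v) = 0) \<and>
    \<tau> 3 v = 1 \<and> \<tau> 4 v = of_bool (v \<notin> T - \<sigma> 7 ` {..<s}))"
  have "?P n \<tau>" unfolding \<tau>_def initialise_def
  proof (rule exec_For[where P = ?P], goal_cases)
    case 1
    then show ?case by (simp add: frame_def)
  next
    case (2 x \<tau>)
    define \<rho> where "\<rho> = upd (upd (upd (upd \<tau> 0 1 x) 2 x 1) 3 x 1) 4 x (1 - of_bool (x \<in> T))"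
    have \<rho>: "\<rho> 0 0 = \<sigma> 0 0" "\<rho> 0 1 = x" "\<rho> 1 = \<sigma> 1" "\<rho> 7 = \<sigma> 7" "\<rho> 2 = (\<tau> 2)(x := 1)" "\<rho> 3 = (\<tau> 3)(x := 1)"
      "\<rho> 4 = (\<tau> 4)(x := 1 - of_bool (x \<in> T))"
      using 2 by (simp_all add: \<rho>_def frame_def)
    let ?\<tau> = "exec rd (mark s) \<rho>"
    have m: "?\<tau> 2 x = (if \<exists>i<s. rd (\<sigma> 1 (\<sigma> 7 i) + x) > 0 then 0 else 1)"
      "?\<tau> 4 x = (if \<exists>i<s. \<sigma> 7 i = x then 1 else 1 - of_bool (x \<in> T))"
      "\<And>v. v \<noteq> x \<Longrightarrow> ?\<tau> 2 v = \<tau> 2 v \<and> ?\<tau> 4 v = \<tau> 4 v" "?\<tau> 3 = (\<tau> 3)(x := 1)"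
      "?\<tau> 0 = \<rho> 0" "?\<tau> 1 = \<sigma> 1" "?\<tau> 7 = \<sigma> 7"
      using exec_mark[of s \<rho>, unfolded \<rho>] \<rho> by auto
    have "frame \<sigma> ?\<tau>" using m \<rho>(1) by (simp add: frame_def)
    moreover have "?\<tau> 2 x = of_bool (\<forall>i<s. rd (\<sigma> 1 (\<sigma> 7 i) + x) = 0)" unfolding m(1) by auto
    moreover have "?\<tau> 4 x = of_bool (x \<notin> T - \<sigma> 7 ` {..<s})" unfolding m(2) by auto
    ultimately have "?P (Suc x) ?\<tau>" using 2 m(3,4) by (simp add: less_Suc_eq)
    then show ?case using 2 rd_T[of x] by (simp add: \<rho>_def)
  qed
  then show "frame \<sigma> \<tau>" "live \<tau> = {v. v < n \<and> (\<forall>i<s. rd (\<sigma> 1 (\<sigma> 7 i) + v) = 0)}"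
    "\<And>v. v < n \<Longrightarrow> \<tau> 3 v = 1" "\<And>v. v < n \<Longrightarrow> \<tau> 4 v = of_bool (v \<notin> T - \<sigma> 7 ` {..<s})"
    by (auto simp: live_def)
qed

lemma exec_test_total:
  fixes \<sigma>
  defines "\<tau> \<equiv> exec rd test_total \<sigma>"
  shows "\<And>j. j \<noteq> 0 \<Longrightarrow> \<tau> j = \<sigma> j"
    and "\<tau> 0 0 = (if n \<le> k + sum (\<sigma> 4) (live \<sigma>) then 1 else \<sigma> 0 0)"
proof -
  let ?c = "For 0 1 (If (Arr 2 (V 1)) (Set 0 (N 4) (Plus (V 4) (Arr 4 (V 1)))) Skip)"
  let ?\<sigma> = "exec rd ?c (upd \<sigma> 0 4 0)"
  have "(\<forall>j. j \<noteq> 0 \<longrightarrow> ?\<sigma> j = \<sigma> j) \<and> ?\<sigma> 0 0 = \<sigma> 0 0 \<and> ?\<sigma> 0 4 = (\<Sum>v<n. if \<sigma> 2 v > 0 then \<sigma> 4 v else 0)"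
    by (rule exec_For[where P = "\<lambda>x \<tau>. (\<forall>j. j \<noteq> 0 \<longrightarrow> \<tau> j = \<sigma> j) \<and> \<tau> 0 0 = \<sigma> 0 0 \<and>
        \<tau> 0 4 = (\<Sum>v<x. if \<sigma> 2 v > 0 then \<sigma> 4 v else 0)"]) auto
  moreover have "(\<Sum>v<n. if \<sigma> 2 v > 0 then \<sigma> 4 v else 0) = sum (\<sigma> 4) (live \<sigma>)"
    unfolding live_def by (subst sum.inter_filter[symmetric]) (auto intro: sum.cong)
  ultimately show "\<And>j. j \<noteq> 0 \<Longrightarrow> \<tau> j = \<sigma> j" "\<tau> 0 0 = (if n \<le> k + sum (\<sigma> 4) (live \<sigma>) then 1 else \<sigma> 0 0)"
    unfolding \<tau>_def test_total_def by (auto simp: exec_accept)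
qed

lemma exec_test_weights:
  fixes \<sigma>
  defines "\<tau> \<equiv> exec rd test_weights \<sigma>"
  shows "\<And>j. j \<noteq> 0 \<Longrightarrow> \<tau> j = \<sigma> j"
    and "\<tau> 0 0 = (if \<exists>v \<in> live \<sigma>. n \<le> k + \<sigma> 3 v then 1 else \<sigma> 0 0)"
proof -
  have "(\<forall>j. j \<noteq> 0 \<longrightarrow> \<tau> j = \<sigma> j) \<and> \<tau> 0 0 = (if \<exists>v<n. v \<in> live \<sigma> \<and> n \<le> k + \<sigma> 3 v then 1 else \<sigma> 0 0)"
    unfolding \<tau>_def test_weights_def
    by (rule exec_For[where P = "\<lambda>x \<tau>. (\<forall>j. j \<noteq> 0 \<longrightarrow> \<tau> j = \<sigma> j) \<and>
        \<tau> 0 0 = (if \<exists>v<x. v \<in> live \<sigma> \<and> n \<le> k + \<sigma> 3 v then 1 else \<sigma> 0 0)"])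
      (auto simp: exec_accept less_Suc_eq live_def)
  then show "\<And>j. j \<noteq> 0 \<Longrightarrow> \<tau> j = \<sigma> j"
    "\<tau> 0 0 = (if \<exists>v \<in> live \<sigma>. n \<le> k + \<sigma> 3 v then 1 else \<sigma> 0 0)"
    by (auto simp: live_def)
qed

lemma exec_distinguish:
  fixes \<sigma>
  defines "\<tau> \<equiv> exec rd distinguish \<sigma>" and "u \<equiv> \<sigma> 0 1" and "v \<equiv> \<sigma> 0 2"
  assumes "rows \<sigma>" "u < n" "v < n"
  shows "\<And>j. j \<noteq> 0 \<Longrightarrow> \<tau> j = \<sigma> j" "\<tau> 0 0 = \<sigma> 0 0" "\<tau> 0 1 = u" "\<tau> 0 2 = v"
    "\<tau> 0 5 = of_bool (\<exists>w \<in> live \<sigma> - {u, v}. E u w \<noteq> E v w)"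
proof -
  let ?c = "For 0 3 (Ifs [Arr 2 (V 3), neq (V 1) (V 3), neq (V 2) (V 3), neq (adj (V 1) (V 3)) (adj (V 2) (V 3))]
       (Set 0 (N 5) (N 1)))"
  let ?P = "\<lambda>x \<tau>. (\<forall>j. j \<noteq> 0 \<longrightarrow> \<tau> j = \<sigma> j) \<and> \<tau> 0 0 = \<sigma> 0 0 \<and> \<tau> 0 1 = u \<and> \<tau> 0 2 = v \<and>
      \<tau> 0 5 = of_bool (\<exists>w<x. w \<in> live \<sigma> - {u, v} \<and> E u w \<noteq> E v w)"
  have "?P n (exec rd ?c (upd \<sigma> 0 5 0))"
  proof (rule exec_For[where P = ?P], goal_cases)
    case 1
    then show ?case by (simp add: u_def v_def)
  next
    case (2 x \<tau>)
    let ?\<tau> = "upd \<tau> 0 3 x"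
    have "rows ?\<tau>" using 2 assms(4) by (simp add: rows_def)
    then have "eval rd (adj (V 1) (V 3)) ?\<tau> = of_bool (E u x)" "eval rd (adj (V 2) (V 3)) ?\<tau> = of_bool (E v x)"
      using 2 assms(5,6) by (auto simp: eval_adj[of ?\<tau> _ u _ x] eval_adj[of ?\<tau> _ v _ x])
    then have "(\<forall>e\<in>set [Arr 2 (V 3), neq (V 1) (V 3), neq (V 2) (V 3), neq (adj (V 1) (V 3)) (adj (V 2) (V 3))].
        eval rd e ?\<tau> > 0) \<longleftrightarrow> x \<in> live \<sigma> - {u, v} \<and> E u x \<noteq> E v x"
      using 2 by (auto simp: live_def)
    then have step: "exec rd (Ifs [Arr 2 (V 3), neq (V 1) (V 3), neq (V 2) (V 3), neq (adj (V 1) (V 3)) (adj (V 2) (V 3))]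
        (Set 0 (N 5) (N 1))) ?\<tau> = (if x \<in> live \<sigma> - {u, v} \<and> E u x \<noteq> E v x then upd ?\<tau> 0 5 1 else ?\<tau>)"
      unfolding exec_Ifs by simp
    have "(\<exists>w<Suc x. Q w) \<longleftrightarrow> Q x \<or> (\<exists>w<x. Q w)" for Q by (auto simp: less_Suc_eq)
    then show ?case unfolding step using 2 by simp
  qed
  then show "\<And>j. j \<noteq> 0 \<Longrightarrow> \<tau> j = \<sigma> j" "\<tau> 0 0 = \<sigma> 0 0" "\<tau> 0 1 = u" "\<tau> 0 2 = v"
    "\<tau> 0 5 = of_bool (\<exists>w \<in> live \<sigma> - {u, v}. E u w \<noteq> E v w)"
    unfolding \<tau>_def distinguish_def by (auto simp: live_def)
qed

text \<open>The guard, a lowered flag together with two distinct live vertices, amounts to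
  \<open>twins\<close>; the new weights have the shape of
  \<open>weights_merge_twins\<close>.\<close>

lemma exec_merge:
  fixes \<sigma>
  defines "\<tau> \<equiv> exec rd merge \<sigma>" and "u \<equiv> \<sigma> 0 1" and "v \<equiv> \<sigma> 0 2"
  assumes "rows \<sigma>" "u < n" "v < n"
  shows "frame \<sigma> \<tau> \<and> \<tau> 0 1 = u \<and> \<tau> 2 = (if twins E (live \<sigma>) u v then (\<sigma> 2)(v := 0) else \<sigma> 2) \<and>
    (\<tau> 3, \<tau> 4) = (if twins E (live \<sigma>) u v then
      ((\<sigma> 3)(u := if E u v then max (\<sigma> 3 u) (max (\<sigma> 3 v) (\<sigma> 4 u + \<sigma> 4 v)) else \<sigma> 3 u + \<sigma> 3 v),
       (\<sigma> 4)(u := \<sigma> 4 u + \<sigma> 4 v)) else (\<sigma> 3, \<sigma> 4))"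
proof -
  let ?\<sigma> = "exec rd distinguish \<sigma>"
  note d = exec_distinguish[OF assms(4), folded u_def v_def, OF assms(5,6)]
  have rows: "rows ?\<sigma>" using d(1) assms(4) by (simp add: rows_def)
  have adj: "eval rd (adj (V 1) (V 2)) ?\<sigma> = of_bool (E u v)"
    using eval_adj[OF rows, of "V 1" u "V 2" v] d(3,4) assms(5,6) by simp
  have "(\<forall>e\<in>set [Minus (N 1) (V 5), Arr 2 (V 1), Arr 2 (V 2), neq (V 1) (V 2)]. eval rd e ?\<sigma> > 0) \<longleftrightarrow>
      twins E (live \<sigma>) u v"
    using d assms(5,6) by (auto simp: twins_def live_def)
  then have "\<tau> = (if twins E (live \<sigma>) u v then exec rd unite ?\<sigma> else ?\<sigma>)"
    unfolding \<tau>_def merge_def exec.simps exec_Ifs by (simp only:)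
  then show ?thesis using d adj by (auto simp: unite_def frame_def)
qed

section \<open>Progress of the twin reduction\<close>

lemma live_upd [simp]: "j \<noteq> 2 \<Longrightarrow> live (upd \<sigma> j i x) = live \<sigma>"
  by (simp add: live_def)

lemma frame_upd [simp]: "i \<noteq> 0 \<Longrightarrow> frame \<sigma> (upd \<tau> 0 i x) = frame \<sigma> \<tau>"
  by (simp add: frame_def)

lemma frame_trans: "frame \<sigma> \<tau> \<Longrightarrow> frame \<tau> \<rho> \<Longrightarrow> frame \<sigma> \<rho>"
  by (simp add: frame_def)

lemma rows_frame: "rows \<sigma> \<Longrightarrow> frame \<sigma> \<tau> \<Longrightarrow> rows \<tau>"
  by (simp add: rows_def frame_def)

lemma finite_live: "finite (live \<sigma>)"
  by (simp add: live_def)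

abbreviation weighted :: "nat set \<Rightarrow> nat set \<Rightarrow> store \<Rightarrow> bool" where
  "weighted S U \<sigma> \<equiv> weights E S U (live \<sigma>) (\<sigma> 3) (\<sigma> 4)"

lemma merge_step:
  fixes \<sigma>
  defines "\<tau> \<equiv> exec rd merge \<sigma>" and "u \<equiv> \<sigma> 0 1" and "v \<equiv> \<sigma> 0 2"
  assumes "rows \<sigma>" "weighted S U \<sigma>" "finite U" "u < n" "v < n"
  shows "frame \<sigma> \<tau>" "\<tau> 0 1 = u" "weighted S U \<tau>" "live \<tau> \<subseteq> live \<sigma>"
    "live \<tau> = live \<sigma> \<Longrightarrow> \<not> twins E (live \<sigma>) u v"
proof -
  note m = exec_merge[OF assms(4), folded u_def v_def \<tau>_def, OF assms(7,8)]
  show "frame \<sigma> \<tau>" "\<tau> 0 1 = u" using m by auto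
  have "weighted S U \<tau> \<and> live \<tau> \<subseteq> live \<sigma> \<and> (live \<tau> = live \<sigma> \<longrightarrow> \<not> twins E (live \<sigma>) u v)"
  proof (cases "twins E (live \<sigma>) u v")
    case True
    then have "live \<tau> = live \<sigma> - {v}" using m by (auto simp: live_def)
    moreover have "v \<in> live \<sigma>" using True by (simp add: twins_def)
    ultimately show ?thesis using m True weights_merge_twins[OF assms(5) True sym assms(6)] by auto
  next
    case False
    then show ?thesis using m assms(5) by (simp add: live_def)
  qed
  then show "weighted S U \<tau>" "live \<tau> \<subseteq> live \<sigma>" "live \<tau> = live \<sigma> \<Longrightarrow> \<not> twins E (live \<sigma>) u v"
    by blast+
qed

text \<open>The live set only shrinks. If it is the same after a sweep, it was the same throughout,
  so every pair was tested against the initial live set: a sweep without progress certifies that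
  there are no twins.\<close>

lemma exec_sweep:
  fixes \<sigma>
  defines "\<tau> \<equiv> exec rd sweep \<sigma>"
  assumes "rows \<sigma>" "weighted S U \<sigma>" "finite U"
  shows "frame \<sigma> \<tau>" "weighted S U \<tau>" "live \<tau> \<subseteq> live \<sigma>"
    "live \<tau> = live \<sigma> \<Longrightarrow> \<not> twins E (live \<sigma>) u v"
proof -
  let ?P = "\<lambda>x \<tau>. frame \<sigma> \<tau> \<and> weighted S U \<tau> \<and> live \<tau> \<subseteq> live \<sigma> \<and>
    (live \<tau> = live \<sigma> \<longrightarrow> (\<forall>u<x. \<forall>v<n. \<not> twins E (live \<sigma>) u v))"
  let ?Q = "\<lambda>x y \<tau>. ?P x \<tau> \<and> \<tau> 0 1 = x \<and> (live \<tau> = live \<sigma> \<longrightarrow> (\<forall>v<y. \<not> twins E (live \<sigma>) x v))"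
  have "?P n \<tau>" unfolding \<tau>_def sweep_def
  proof (rule exec_For[where P = ?P], goal_cases)
    case 1
    then show ?case using assms(3) by (simp add: frame_def)
  next
    case outer: (2 x \<tau>)
    have "?Q x n (exec rd (For 0 2 merge) (upd \<tau> 0 1 x))"
    proof (rule exec_For[where P = "?Q x"], goal_cases)
      case 1
      then show ?case using outer by simp
    next
      case (2 y \<rho>)
      let ?\<rho> = "upd \<rho> 0 2 y"
      have pre: "rows ?\<rho>" "weighted S U ?\<rho>" "?\<rho> 0 1 = x" "?\<rho> 0 2 = y" "frame \<sigma> ?\<rho>"
        using 2 rows_frame[OF assms(2), of ?\<rho>] by simp_all
      note m = merge_step[OF pre(1,2) assms(4), unfolded pre(3,4), OF outer(1) 2(1)]
      have sub: "live (exec rd merge ?\<rho>) \<subseteq> live \<rho>" using m(4) by simp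
      have same: "live \<rho> = live \<sigma>" if "live (exec rd merge ?\<rho>) = live \<sigma>"
        using that sub 2 by blast
      have "\<not> twins E (live \<sigma>) x v" if "live (exec rd merge ?\<rho>) = live \<sigma>" "v < Suc y" for v
        using same[OF that(1)] m(5) that 2 by (cases "v = y") auto
      moreover have "\<forall>u<x. \<forall>v<n. \<not> twins E (live \<sigma>) u v" if "live (exec rd merge ?\<rho>) = live \<sigma>"
        using same[OF that] 2 by simp
      moreover have "live (exec rd merge ?\<rho>) \<subseteq> live \<sigma>" using sub 2 by blast
      ultimately show ?case using m(2,3) frame_trans[OF pre(5) m(1)] by simp
    qed
    then show ?case by (simp add: less_Suc_eq_le le_less)
  qed
  then show "frame \<sigma> \<tau>" "weighted S U \<tau>" "live \<tau> \<subseteq> live \<sigma>"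
    "live \<tau> = live \<sigma> \<Longrightarrow> \<not> twins E (live \<sigma>) u v"
    by (auto simp: twins_def live_def)
qed

text \<open>P4-freeness passes to the shrinking live set, which therefore has twins while two
  vertices remain, and the preceding certificate forces progress. Starting from at most
  \<open>n\<close> live vertices, \<open>n\<close> sweeps leave at most one.\<close>

lemma exec_sweeps:
  fixes \<sigma>
  defines "\<tau> \<equiv> exec rd (For 0 6 sweep) \<sigma>"
  assumes "rows \<sigma>" "weighted S U \<sigma>" "finite U"
  shows "frame \<sigma> \<tau>" "weighted S U \<tau>" "\<not> contains_P4 E (live \<sigma>) \<Longrightarrow> card (live \<tau>) \<le> 1"
proof -
  let ?P = "\<lambda>x \<tau>. frame \<sigma> \<tau> \<and> weighted S U \<tau> \<and> live \<tau> \<subseteq> live \<sigma> \<and>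
    (\<not> contains_P4 E (live \<sigma>) \<longrightarrow> card (live \<tau>) \<le> 1 \<or> card (live \<tau>) + x \<le> n)"
  have "?P n \<tau>" unfolding \<tau>_def
  proof (rule exec_For[where P = ?P], goal_cases)
    case 1
    have "card (live \<sigma>) \<le> n" using card_mono[of "{..<n}" "live \<sigma>"] by (auto simp: live_def)
    then show ?case using assms(3) by (simp add: frame_def)
  next
    case (2 x \<tau>)
    let ?\<tau> = "upd \<tau> 0 6 x"
    have pre: "rows ?\<tau>" "weighted S U ?\<tau>" "frame \<sigma> ?\<tau>"
      using 2 rows_frame[OF assms(2), of ?\<tau>] by simp_all
    note w = exec_sweep[OF pre(1,2) assms(4)]
    let ?\<rho> = "exec rd sweep ?\<tau>"
    have sub: "live ?\<rho> \<subseteq> live \<tau>" using w(3) by simp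
    have "card (live ?\<rho>) \<le> 1 \<or> card (live ?\<rho>) + Suc x \<le> n" if free: "\<not> contains_P4 E (live \<sigma>)"
    proof (cases "card (live \<tau>) \<le> 1")
      case True
      then show ?thesis using card_mono[OF finite_live sub] by linarith
    next
      case False
      have "\<not> contains_P4 E (live \<tau>)" using free 2 contains_P4_mono by blast
      then obtain u v where "twins E (live \<tau>) u v"
        using cograph_has_twins[OF finite_live sym, of \<tau>] False by auto
      then have "live ?\<rho> \<subset> live \<tau>" using w(4)[of u v] sub by auto
      then have "card (live ?\<rho>) < card (live \<tau>)" by (rule psubset_card_mono[OF finite_live])
      then show ?thesis using 2 free False by linarith
    qed
    then show ?case using 2 w(2) sub frame_trans[OF pre(3) w(1)] by blast
  qed
  then show "frame \<sigma> \<tau>" "weighted S U \<tau>" "\<not> contains_P4 E (live \<sigma>) \<Longrightarrow> card (live \<tau>) \<le> 1"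
    by auto
qed

section \<open>Soundness and completeness of a tuple and of the search over all tuples\<close>

definition undominated :: "nat \<Rightarrow> store \<Rightarrow> nat set" where
  "undominated s \<sigma> = {v. v < n \<and> (\<forall>i<s. rd (\<sigma> 1 (\<sigma> 7 i) + v) = 0)}"

text \<open>A tuple vertex taken out of \<open>T\<close> has no neighbour among the undominated
  vertices, so it cannot violate goodness there.\<close>

lemma good_if_relaxed:
  assumes "rows \<sigma>" "I \<subseteq> undominated s \<sigma>" "good E (T - \<sigma> 7 ` {..<s}) I"
  shows "good E T I"
  unfolding good_def
proof (intro ballI)
  fix t x assume t: "t \<in> I \<inter> T" and x: "x \<in> I"
  show "\<not> E t x"
  proof (cases "t \<in> \<sigma> 7 ` {..<s}")
    case True
    then obtain i where "i < s" "t = \<sigma> 7 i" by blast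
    then have "rd (\<sigma> 1 t + x) = 0" "t < n" "x < n" using assms(2) t x by (auto simp: undominated_def)
    then show ?thesis using assms(1) rd_E[of t x] by (simp add: rows_def)
  next
    case False
    then show ?thesis using assms(3) t x unfolding good_def by blast
  qed
qed

text \<open>The third claim is soundness, for an arbitrary tuple. The fourth is completeness; its
  two alternatives correspond to the test of the total and to the test of the weights.\<close>

lemma exec_try_tuple:
  fixes \<sigma> s
  defines "\<tau> \<equiv> exec rd (try_tuple s) \<sigma>" and "S \<equiv> T - \<sigma> 7 ` {..<s}" and "U \<equiv> undominated s \<sigma>"
  assumes "rows \<sigma>"
  shows "rows \<tau>" "\<tau> 7 = \<sigma> 7" "\<tau> 0 0 = \<sigma> 0 0 \<or> \<tau> 0 0 = 1 \<and> solvable"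
    "\<And>I. I \<subseteq> U \<Longrightarrow> good E S I \<Longrightarrow> n \<le> k + card I \<Longrightarrow> I \<inter> S = {} \<or> \<not> contains_P4 E U \<Longrightarrow> \<tau> 0 0 = 1"
proof -
  define \<sigma>1 where "\<sigma>1 = exec rd (initialise s) \<sigma>"
  define \<sigma>2 where "\<sigma>2 = exec rd test_total \<sigma>1"
  define \<sigma>3 where "\<sigma>3 = exec rd (For 0 6 sweep) \<sigma>2"
  have \<tau>: "\<tau> = exec rd test_weights \<sigma>3"
    by (simp add: \<tau>_def \<sigma>1_def \<sigma>2_def \<sigma>3_def try_tuple_def)
  note i = exec_initialise[where \<sigma> = \<sigma> and s = s, folded \<sigma>1_def undominated_def, folded S_def U_def]
  note t = exec_test_total[where \<sigma> = \<sigma>1, folded \<sigma>2_def, unfolded i(2)]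
  note w = exec_test_weights[where \<sigma> = \<sigma>3, folded \<tau>]
  have finU: "finite U" and Un: "U \<subseteq> {..<n}" by (auto simp: U_def undominated_def)
  have rows1: "rows \<sigma>1" using i(1) assms(4) rows_frame by blast
  then have rows2: "rows \<sigma>2" using t(1) by (simp add: rows_def)
  have live2: "live \<sigma>2 = U" using t(1) i(2) by (simp add: live_def)
  have "weights E S U U (\<sigma>1 3) (\<sigma>1 4) = weights E S U U (\<lambda>_. 1) (\<lambda>v. of_bool (v \<notin> S))"
    using i(3,4) Un by (intro weights_cong) auto
  then have "weighted S U \<sigma>2" using t(1) weights_singletons[of E S U] irrefl live2 by simp
  note r = exec_sweeps[OF rows2 this finU, folded \<sigma>3_def, unfolded live2]
  have "sum (\<sigma>1 4) U = (\<Sum>v\<in>U. of_bool (v \<notin> S))" using i(4) Un by (intro sum.cong) auto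
  also have "\<dots> = card (U - S)" using finU by (simp add: sum.If_cases of_bool_def Diff_eq Compl_eq)
  finally have ans2: "\<sigma>2 0 0 = (if n \<le> k + card (U - S) then 1 else \<sigma> 0 0)"
    using t(2) i(1) by (simp add: frame_def)
  have ans3: "\<sigma>3 0 0 = \<sigma>2 0 0" using r(1) by (simp add: frame_def)
  have "rows \<sigma>3" using r(1) rows2 rows_frame by blast
  then show "rows \<tau>" using w(1) by (simp add: rows_def)
  show "\<tau> 7 = \<sigma> 7" using i(1) r(1) t(1) w(1) by (simp add: frame_def)
  have wit: "solvable" if "I \<subseteq> U" "good E S I" "n \<le> k + card I" for I
  proof -
    have "good E T I" using good_if_relaxed[OF assms(4)] that(1,2) unfolding U_def S_def by blast
    moreover have "I \<subseteq> {..<n}" using that(1) Un by (rule subset_trans)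
    ultimately show ?thesis using that(3) unfolding solvable_def by auto
  qed
  have "solvable" if "n \<le> k + card (U - S)"
    by (rule wit[OF _ _ that]) (auto simp: good_def)
  moreover have "solvable" if "v \<in> live \<sigma>3" "n \<le> k + \<sigma>3 3 v" for v
    using weights_max_good_le[OF r(2) that(1)] wit that(2) by auto
  ultimately show "\<tau> 0 0 = \<sigma> 0 0 \<or> \<tau> 0 0 = 1 \<and> solvable"
    using w(2) ans2 ans3 by auto
  show "\<tau> 0 0 = 1"
    if I: "I \<subseteq> U" "good E S I" "n \<le> k + card I" and or: "I \<inter> S = {} \<or> \<not> contains_P4 E U" for I
  proof (cases "n \<le> k + card (U - S)")
    case True
    then show ?thesis using w(2) ans2 ans3 by auto
  next
    case False
    \<comment> \<open>An \<open>I\<close> avoiding \<open>S\<close> would have passed the test of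
      the total, so the other alternative holds: \<open>U\<close> is P4-free and at most one module
      is left.\<close>
    have "card I \<le> card (U - S)" if "I \<inter> S = {}"
      using that I(1) finU by (intro card_mono) auto
    then have "card (live \<sigma>3) \<le> 1" using False I(3) or r(3) by auto
    then obtain x where x: "live \<sigma>3 \<subseteq> {x}"
      using card_le_Suc0_iff_eq[OF finite_live] by (metis One_nat_def empty_subsetI subsetI equals0I singleton_iff)
    have "I \<noteq> {}" using False I(3) by auto
    then have "x \<in> live \<sigma>3" "card I \<le> \<sigma>3 3 x" using weights_one[OF r(2) x I(1,2)] by auto
    then have "\<exists>v \<in> live \<sigma>3. n \<le> k + \<sigma>3 3 v" using I(3) by (intro bexI[of _ x]) auto
    then show ?thesis using w(2) by simp
  qed
qed

text \<open>Positions are filled from the highest down, so the claim for \<open>m\<close> assumes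
  agreement with the target tuple \<open>a\<close> from \<open>m\<close> on. \<open>P\<close> is
  kept by every run; \<open>Q\<close> holds once the target has been tried and persists.\<close>

lemma exec_for_tuples:
  assumes pres: "\<And>\<sigma>. P \<sigma> \<Longrightarrow> P (exec rd c \<sigma>) \<and> exec rd c \<sigma> 7 = \<sigma> 7 \<and> (Q \<sigma> \<longrightarrow> Q (exec rd c \<sigma>))"
    and upd: "\<And>\<sigma> i x. P \<sigma> \<Longrightarrow> P (upd \<sigma> 7 i x)" "\<And>\<sigma> i x. Q (upd \<sigma> 7 i x) = Q \<sigma>"
    and hit: "\<And>\<sigma>. P \<sigma> \<Longrightarrow> (\<And>i. i < s \<Longrightarrow> \<sigma> 7 i = a i) \<Longrightarrow> Q (exec rd c \<sigma>)"
    and a: "\<And>i. a i \<le> n" and "m \<le> s" "P \<sigma>"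
  shows "P (exec rd (for_tuples m c) \<sigma>) \<and> (\<forall>i\<ge>m. exec rd (for_tuples m c) \<sigma> 7 i = \<sigma> 7 i) \<and>
    (Q \<sigma> \<or> (\<forall>i<s. m \<le> i \<longrightarrow> \<sigma> 7 i = a i) \<longrightarrow> Q (exec rd (for_tuples m c) \<sigma>))"
  using assms(6,7)
proof (induction m arbitrary: \<sigma>)
  case 0
  then show ?case using pres[of \<sigma>] hit[of \<sigma>] by auto
next
  case (Suc m)
  let ?\<sigma> = "upd \<sigma> 7 m n"
  let ?\<rho> = "exec rd (for_tuples m c) ?\<sigma>"
  let ?A = "\<lambda>\<sigma>. \<forall>i<s. Suc m \<le> i \<longrightarrow> \<sigma> 7 i = a i"
  have \<rho>: "P ?\<rho>" "\<forall>i\<ge>m. ?\<rho> 7 i = ?\<sigma> 7 i" "Q ?\<sigma> \<or> (\<forall>i<s. m \<le> i \<longrightarrow> ?\<sigma> 7 i = a i) \<longrightarrow> Q ?\<rho>"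
    using Suc.IH[OF Suc_leD[OF Suc.prems(1)] upd(1)[OF Suc.prems(2)], of m n] by - (elim conjE, assumption)+
  have upd_m: "\<forall>i<s. m \<le> i \<longrightarrow> upd \<tau> 7 m (a m) 7 i = a i" if "?A \<tau>" for \<tau>
    using that by (auto simp: Suc_le_eq)
  \<comment> \<open>The loop counter only takes values below \<open>n\<close>; the value
    \<open>n\<close> was tried before the loop, hence the separate alternative
    \<open>a m = n\<close>.\<close>
  let ?P = "\<lambda>x \<tau>. P \<tau> \<and> (\<forall>i\<ge>Suc m. \<tau> 7 i = \<sigma> 7 i) \<and> (Q \<sigma> \<or> ?A \<sigma> \<and> (a m = n \<or> a m < x) \<longrightarrow> Q \<tau>)"
  have "?P n (exec rd (For 7 m (for_tuples m c)) ?\<rho>)"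
  proof (rule exec_For[where P = ?P], goal_cases)
    case 1
    have "Q ?\<rho>" if "?A \<sigma>" "a m = n" using upd_m[of \<sigma>, OF that(1)] \<rho>(3) that(2) by simp
    then show ?case using \<rho> upd(2) by auto
  next
    case (2 x \<tau>)
    let ?\<tau> = "upd \<tau> 7 m x"
    have IH: "P (exec rd (for_tuples m c) ?\<tau>)" "\<forall>i\<ge>m. exec rd (for_tuples m c) ?\<tau> 7 i = ?\<tau> 7 i"
      "Q ?\<tau> \<or> (\<forall>i<s. m \<le> i \<longrightarrow> ?\<tau> 7 i = a i) \<longrightarrow> Q (exec rd (for_tuples m c) ?\<tau>)"
      using Suc.IH[OF Suc_leD[OF Suc.prems(1)] upd(1), of \<tau> m x] 2 by blast+
    have "Q (exec rd (for_tuples m c) ?\<tau>)" if "?A \<sigma>" "a m = x"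
      using upd_m[of \<tau>] IH(3) that 2 by auto
    moreover have "Q (exec rd (for_tuples m c) ?\<tau>)" if "Q \<tau>" using that IH(3) upd(2) by blast
    moreover have "a m < Suc x \<longleftrightarrow> a m < x \<or> a m = x" by auto
    moreover have "\<forall>i\<ge>Suc m. exec rd (for_tuples m c) ?\<tau> 7 i = \<sigma> 7 i" using IH(2) 2 by simp
    ultimately show ?case using IH(1) 2 by blast
  qed
  then show ?case using a[of m] by (auto simp: rd_size le_less)
qed

text \<open>\<open>free\<close> is the form in which freeness is consumed. Taking \<open>u\<close>
  in \<open>A\<close> shows that \<open>A\<close> is independent; as a subset of the good set it
  lies in the undominated set, as required.\<close>

lemma exec_svc_program:
  assumes free: "\<And>A U. A \<subseteq> U \<Longrightarrow> U \<subseteq> {..<n} \<Longrightarrow> card A = s \<Longrightarrow> (\<And>a u. a \<in> A \<Longrightarrow> u \<in> U \<Longrightarrow> \<not> E a u) \<Longrightarrow>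
    \<not> contains_P4 E U"
  shows "exec rd (svc_program s) (\<lambda>_ _. 0) 0 0 = of_bool solvable"
proof -
  define \<sigma> where "\<sigma> = exec rd row_offsets (\<lambda>_ _. 0)"
  define \<tau> where "\<tau> = exec rd (for_tuples s (try_tuple s)) \<sigma>"
  define P where "P \<sigma> \<longleftrightarrow> rows \<sigma> \<and> (\<sigma> 0 0 = 0 \<or> \<sigma> 0 0 = 1 \<and> solvable)" for \<sigma>
  define Q where "Q \<sigma> \<longleftrightarrow> \<sigma> 0 0 = (1::nat)" for \<sigma> :: store
  have P: "P \<sigma>" unfolding \<sigma>_def P_def using exec_row_offsets[of "\<lambda>_ _. 0"] by simp
  have pres: "P (exec rd (try_tuple s) \<sigma>) \<and> exec rd (try_tuple s) \<sigma> 7 = \<sigma> 7 \<and> (Q \<sigma> \<longrightarrow> Q (exec rd (try_tuple s) \<sigma>))"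
    if "P \<sigma>" for \<sigma>
    using exec_try_tuple(1-3)[where \<sigma> = \<sigma> and s = s] that by (auto simp: P_def Q_def)
  have upd: "P (upd \<sigma> 7 i x)" if "P \<sigma>" for \<sigma> i x using that by (simp add: P_def rows_def)
  have upd_Q: "Q (upd \<sigma> 7 i x) = Q \<sigma>" for \<sigma> i x by (simp add: Q_def)
  have "\<tau> 0 0 = 1" if sol: solvable
  proof -
    obtain I where I: "I \<subseteq> {..<n}" "good E T I" "n \<le> k + card I"
      using sol unfolding solvable_def by blast
    obtain A where A: "A \<subseteq> I \<inter> T" "card A \<le> s" "A = I \<inter> T \<or> card A = s"
    proof (cases "card (I \<inter> T) \<le> s")
      case True
      then show ?thesis using that[of "I \<inter> T"] by blast
    next
      case False
      then obtain A where "A \<subseteq> I \<inter> T" "card A = s" by (meson nat_le_linear obtain_subset_with_card_n)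
      then show ?thesis using that[of A] by simp
    qed
    have "finite A" using A(1) I(1) by (meson finite_Int finite_lessThan finite_subset)
    then obtain h where h: "bij_betw h {..<card A} A" by (metis ex_bij_betw_nat_finite lessThan_atLeast0)
    \<comment> \<open>Positions beyond the size of \<open>A\<close> are padded with the
      blank.\<close>
    define a where "a i = (if i < card A then h i else n)" for i
    have a_le: "a i \<le> n" for i
    proof (cases "i < card A")
      case True
      then have "h i \<in> {..<n}" using h A(1) I(1) bij_betwE by blast
      then show ?thesis by (simp add: a_def)
    qed (simp add: a_def)
    have a_img: "a ` {..<card A} = A" using h by (simp add: a_def bij_betw_def)
    have a_A: "A \<subseteq> a ` {..<s}" "a i < n \<Longrightarrow> a i \<in> A" for i
    proof -
      show "A \<subseteq> a ` {..<s}" using image_mono[of "{..<card A}" "{..<s}" a] A(2) a_img by simp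
      show "a i \<in> A" if "a i < n"
      proof -
        have "i < card A" using that by (simp add: a_def split: if_splits)
        then show ?thesis using a_img by blast
      qed
    qed
    have hit: "Q (exec rd (try_tuple s) \<sigma>)" if P: "P \<sigma>" and a: "\<And>i. i < s \<Longrightarrow> \<sigma> 7 i = a i" for \<sigma>
    proof -
      have row: "rd (\<sigma> 1 (a i) + v) = of_bool (a i < n \<and> E (a i) v)" if "v < n" for i v
        using eval_adj[of \<sigma> "N (a i)" "a i" "N v" v] P a_le[of i] that by (simp add: adj_def P_def)
      have "a ` {..<s} = \<sigma> 7 ` {..<s}" using a by (intro image_cong) auto
      then have A_img: "A \<subseteq> \<sigma> 7 ` {..<s}" using a_A(1) by simp
      have "I \<subseteq> undominated s \<sigma>"
      proof
        fix v assume v: "v \<in> I"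
        have "\<not> (a i < n \<and> E (a i) v)" for i
          using a_A(2)[of i] A(1) I(2) v unfolding good_def by blast
        then show "v \<in> undominated s \<sigma>" using v I(1) row a by (auto simp: undominated_def)
      qed
      moreover have "good E (T - \<sigma> 7 ` {..<s}) I" using I(2) unfolding good_def by blast
      moreover have "I \<inter> (T - \<sigma> 7 ` {..<s}) = {} \<or> \<not> contains_P4 E (undominated s \<sigma>)"
      proof (cases "A = I \<inter> T")
        case True
        then show ?thesis using A_img by blast
      next
        case False
        have "\<not> E x u" if xu: "x \<in> A" "u \<in> undominated s \<sigma>" for x u
        proof -
          obtain i where "i < s" "x = a i" using xu(1) a_A(1) by blast
          moreover have "x < n" using xu(1) A(1) I(1) by blast
          ultimately show ?thesis using xu(2) row[of u i] a by (auto simp: undominated_def)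
        qed
        moreover have "A \<subseteq> undominated s \<sigma>" using A(1) \<open>I \<subseteq> undominated s \<sigma>\<close> by blast
        ultimately show ?thesis using free[of A "undominated s \<sigma>"] A(3) False by (auto simp: undominated_def)
      qed
      ultimately show ?thesis using exec_try_tuple(4)[of \<sigma> I s] P I(3) unfolding P_def Q_def by blast
    qed
    have "P \<tau> \<and> (\<forall>i\<ge>s. \<tau> 7 i = \<sigma> 7 i) \<and> (Q \<sigma> \<or> (\<forall>i<s. s \<le> i \<longrightarrow> \<sigma> 7 i = a i) \<longrightarrow> Q \<tau>)"
      unfolding \<tau>_def
    proof (rule exec_for_tuples[of P "try_tuple s" Q s a s \<sigma>])
      fix \<rho> assume "P \<rho>"
      then show "P (exec rd (try_tuple s) \<rho>) \<and> exec rd (try_tuple s) \<rho> 7 = \<rho> 7 \<and> (Q \<rho> \<longrightarrow> Q (exec rd (try_tuple s) \<rho>))"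
        by (rule pres)
    next
      fix \<rho> i x assume "P \<rho>"
      then show "P (upd \<rho> 7 i x)" by (rule upd)
    next
      fix \<rho> assume "P \<rho>" "\<And>i. i < s \<Longrightarrow> \<rho> 7 i = a i"
      then show "Q (exec rd (try_tuple s) \<rho>)" by (rule hit)
    qed (rule upd_Q a_le le_refl P)+
    then have "Q \<tau>" by simp
    then show ?thesis by (simp add: Q_def)
  qed
  moreover have "P \<tau>"
  proof -
    \<comment> \<open>An unsolvable instance offers no target tuple. The rule is applied with a
      trivial goal and an arbitrary target, only to carry \<open>P\<close> through; \<open>P\<close>
      then rules out a wrong positive answer.\<close>
    have pres': "P (exec rd (try_tuple s) \<rho>) \<and> exec rd (try_tuple s) \<rho> 7 = \<rho> 7 \<and>
        (True \<longrightarrow> True)" if "P \<rho>" for \<rho>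
      using pres[OF that] by simp
    show ?thesis unfolding \<tau>_def
      by (rule conjunct1[OF exec_for_tuples[of P "try_tuple s" "\<lambda>_. True" s "\<lambda>_. 0" s \<sigma>,
            OF pres' upd refl TrueI le0 le_refl P]])
  qed
  ultimately have "\<tau> 0 0 = of_bool solvable" by (auto simp: P_def)
  then show ?thesis by (simp add: \<tau>_def \<sigma>_def svc_program_def)
qed

end

section \<open>Encoded instances\<close>

lemma nth_concat_rows:
  assumes "u < m" "v < n"
  shows "concat (map (\<lambda>u. map (f u) [0..<n]) [0..<m]) ! (u * n + v) = f u v"
  using assms(1)
proof (induction m)
  case 0
  then show ?case by simp
next
  case (Suc m)
  let ?rows = "concat (map (\<lambda>u. map (f u) [0..<n]) [0..<m])"
  have len: "length ?rows = m * n" by (simp add: length_concat o_def sum_list_triv)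
  show ?case
  proof (cases "u < m")
    case True
    then have "u * n + n \<le> m * n" by (metis Suc_leI add.commute mult_Suc mult_le_mono1)
    then show ?thesis using Suc True assms(2) by (simp add: nth_append len)
  next
    case False
    then have "u = m" using Suc.prems by simp
    then show ?thesis using assms(2) by (simp add: nth_append len)
  qed
qed

lemma length_svc_encode:
  "length (svc_encode (G, T, k)) = 2 + card (verts G) + card (verts G) * card (verts G)"
  by (simp add: Let_def length_concat o_def sum_list_triv)

text \<open>Every entry, including 0, contributes at least 1 to the input length.\<close>

lemma length_le_input_length: "length inp \<le> input_length inp"
  unfolding input_length_def by (induction inp) auto

context
  fixes G :: "nat graph" and T :: "nat set" and k n :: nat
  assumes fsg: "finite_simple_graph G" and verts: "verts G = {..<n}" and T: "T \<subseteq> verts G"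
begin

lemma edges_doubletons: "e \<in> edges G \<Longrightarrow> card e = 2"
  using fsg by (simp add: finite_simple_graph_def)

lemma svc_reader_encode:
  "svc_reader (input_at (svc_encode (G, T, k))) n k (\<lambda>u v. {u, v} \<in> edges G) T"
proof
  let ?rd = "input_at (svc_encode (G, T, k))"
  have n: "card (verts G) = n" by (simp add: verts)
  define rows :: "nat list" where
    "rows = concat (map (\<lambda>u. map (\<lambda>v. of_bool ({u, v} \<in> edges G)) [0..<n]) [0..<n])"
  have len_rows: "length rows = n * n" by (simp add: rows_def length_concat o_def sum_list_triv)
  have enc: "svc_encode (G, T, k) = n # k # map (\<lambda>v. of_bool (v \<in> T)) [0..<n] @ rows"
    by (simp add: Let_def n rows_def)
  show "?rd 0 = n" "?rd (Suc 0) = k" by (simp_all add: enc input_at_def del: svc_encode.simps)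
  show "?rd (2 + v) = of_bool (v \<in> T)" if "v < n" for v
    using that by (simp add: enc input_at_def nth_append del: svc_encode.simps)
  show "?rd (2 + n + u * n + v) = of_bool ({u, v} \<in> edges G)" if "u < n" "v < n" for u v
  proof -
    have "u * n + n \<le> n * n" using that(1) by (metis Suc_leI add.commute mult_Suc mult_le_mono1)
    then have "u * n + v < n * n" using that(2) by linarith
    moreover have "rows ! (u * n + v) = of_bool ({u, v} \<in> edges G)"
      unfolding rows_def by (rule nth_concat_rows[OF that])
    ultimately show ?thesis
      using len_rows
      by (simp add: enc input_at_def nth_append add.assoc del: svc_encode.simps)
  qed
  show "?rd (2 + n + n * n + v) = 0" for v
    using length_svc_encode[of G T k] by (simp add: input_at_def n del: svc_encode.simps)
  show "symp (\<lambda>u v. {u, v} \<in> edges G)" by (simp add: symp_def insert_commute)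
  show "{x, x} \<notin> edges G" for x using edges_doubletons[of "{x, x}"] by auto
qed

lemma subset_vertex_cover_iff_good:
  assumes "S \<subseteq> verts G"
  shows "subset_vertex_cover G T S \<longleftrightarrow> good (\<lambda>u v. {u, v} \<in> edges G) T (verts G - S)"
proof
  assume cover: "subset_vertex_cover G T S"
  show "good (\<lambda>u v. {u, v} \<in> edges G) T (verts G - S)"
    unfolding good_def
  proof (intro ballI notI)
    fix t x assume "t \<in> (verts G - S) \<inter> T" "x \<in> verts G - S" "{t, x} \<in> edges G"
    moreover from this have "{t, x} \<inter> S \<noteq> {}"
      using cover by (auto simp only: subset_vertex_cover_def)
    ultimately show False by auto
  qed
next
  assume good: "good (\<lambda>u v. {u, v} \<in> edges G) T (verts G - S)"
  have "e \<inter> S \<noteq> {}" if e: "e \<in> edges G" "e \<inter> T \<noteq> {}" for e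
  proof
    assume disj: "e \<inter> S = {}"
    obtain t where t: "t \<in> e" "t \<in> T" using e(2) by blast
    have "card (e - {t}) = 1" using edges_doubletons[OF e(1)] t(1) by (simp add: card_Diff_singleton)
    then obtain x where "e - {t} = {x}" by (auto simp: card_1_singleton_iff)
    then have ex: "e = {t, x}" using t(1) by blast
    moreover have "e \<subseteq> verts G" using fsg e(1) by (simp add: finite_simple_graph_def)
    ultimately show False using good e(1) t disj unfolding good_def by blast
  qed
  then show "subset_vertex_cover G T S" using assms unfolding subset_vertex_cover_def by blast
qed

lemma svc_yes_iff_solvable:
  "(G, T, k) \<in> svc_yes \<longleftrightarrow> svc_reader.solvable n k (\<lambda>u v. {u, v} \<in> edges G) T"
proof -
  interpret svc_reader "input_at (svc_encode (G, T, k))" n k "\<lambda>u v. {u, v} \<in> edges G" T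
    by (rule svc_reader_encode)
  have card: "card (verts G - S) = n - card S" "card S \<le> n" if "S \<subseteq> verts G" for S
    using that verts card_Diff_subset[of S "verts G"] card_mono[of "verts G" S] finite_subset[of S "verts G"]
    by auto
  show ?thesis
  proof
    assume "(G, T, k) \<in> svc_yes"
    then obtain S where S: "subset_vertex_cover G T S" "card S \<le> k" unfolding svc_yes_def by blast
    then have "S \<subseteq> verts G" unfolding subset_vertex_cover_def by blast
    then show solvable unfolding solvable_def
      using S subset_vertex_cover_iff_good card verts by (intro exI[of _ "verts G - S"]) auto
  next
    assume solvable
    then obtain I where I: "I \<subseteq> {..<n}" "good (\<lambda>u v. {u, v} \<in> edges G) T I" "n \<le> k + card I"
      unfolding solvable_def by blast
    have "verts G - (verts G - I) = I" using I(1) verts by blast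
    then have "subset_vertex_cover G T (verts G - I)"
      using subset_vertex_cover_iff_good[of "verts G - I"] I(2) by simp
    moreover have "card (verts G - I) \<le> k" using card[of I] I(1,3) verts by simp
    ultimately show "(G, T, k) \<in> svc_yes" unfolding svc_yes_def by blast
  qed
qed

lemma svc_program_correct:
  assumes "graph_free (sP1_plus_P4 s) G"
  shows "exec (input_at (svc_encode (G, T, k))) (svc_program s) (\<lambda>_ _. 0) 0 0 = of_bool ((G, T, k) \<in> svc_yes)"
proof -
  interpret svc_reader "input_at (svc_encode (G, T, k))" n k "\<lambda>u v. {u, v} \<in> edges G" T
    by (rule svc_reader_encode)
  have "\<not> contains_P4 (\<lambda>u v. {u, v} \<in> edges G) U"
    if "A \<subseteq> U" "U \<subseteq> {..<n}" "card A = s" "\<And>a u. a \<in> A \<Longrightarrow> u \<in> U \<Longrightarrow> {a, u} \<notin> edges G" for A U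
  proof (rule no_P4_beside_independent_set[of A])
    show "finite A" using that(1,2) by (meson finite_lessThan finite_subset)
    show "graph_free (sP1_plus_P4 (card A)) G" using assms that(3) by simp
    show "U \<subseteq> verts G" using that(2) verts by simp
    show "\<forall>e\<in>edges G. card e = 2" using edges_doubletons by simp
  qed (rule that(1) that(4), assumption?)+
  then show ?thesis unfolding svc_yes_iff_solvable by (rule exec_svc_program)
qed

end

theorem theorem5:
  fixes s :: nat
  assumes "s \<ge> 1"
  shows "svc_poly_time_for {G. graph_free (sP1_plus_P4 s) G}"
  unfolding svc_poly_time_for_def
proof (rule poly_time_solvable_if_exec[OF com_ok_svc_program])
  fix x assume "x \<in> svc_instances {G. graph_free (sP1_plus_P4 s) G}"
  then obtain G T k where x: "x = (G, T, k)" "finite_simple_graph G"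
    "verts G = {..<card (verts G)}" "T \<subseteq> verts G" "graph_free (sP1_plus_P4 s) G"
    unfolding svc_instances_def by blast
  show "exec (input_at (svc_encode x)) (svc_program s) (\<lambda>_ _. 0) 0 0 = of_bool (x \<in> svc_yes)"
    unfolding x(1) by (rule svc_program_correct[OF x(2-5)])
  \<comment> \<open>The encoding has one entry per vertex for \<open>T\<close> alone, so its length
    is at least \<open>n\<close>.\<close>
  show "input_at (svc_encode x) 0 \<le> input_length (svc_encode x)"
    using length_le_input_length[of "svc_encode x"] length_svc_encode[of G T k]
    unfolding x(1) by (simp add: input_at_def Let_def)
qed

end
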